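(* For complex parameters $\mu_1,\mu_2,\mu_3$, let $$\tau_1=\int_{S^{3}\times S^{3}\times S^{3}}\left|\mathrm{Re}\,\omega(y,z)\right|^{-\mu_1-2}\left|\mathrm{Re}\,\omega(z,x)\right|^{-\mu_2-2}\left|\mathrm{Re}\,\omega(x,y)\right|^{-\mu_3-2}\,d\sigma(x)\,d\sigma(y)\,d\sigma(z).$$ Then, as meromorphic functions of $(\mu_1,\mu_2,\mu_3)$, $$\tau_1=\left(2\pi^{\frac{3}{2}}\right)^3\,\Gamma\left(\frac{-\mu_1-\mu_2-\mu_3-2}{2}\right)\prod_{j=1}^3\frac{\Gamma\left(-\frac{1}{2}-\frac{\mu_j}{2}\right)}{\Gamma\left(\frac{\mu_j-\mu_1-\mu_2-\mu_3}{2}\right)}.$$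
   Context: $S^3$ is the unit sphere of $\mathbb{C}^2\simeq\mathbb{R}^4$, and $\sigma$ is its Euclidean (surface, not normalized) measure. $\omega$ is the standard complex symplectic form on $\mathbb{C}^2$: $\omega(X,Y)=X_2Y_1-X_1Y_2$. The integral is originally defined for parameters for which it converges absolutely, then extended meromorphically in the parameters. It is the trace of the composition $T_{\mu_1}T_{\mu_2}T_{\mu_3}$, where $T_\mu f(y)=\int_{S^3}f(x)|\mathrm{Re}\,\omega(x,y)|^{-\mu-2}\,d\sigma(x)$ on $L^2(S^3)$. *)

theory Defs
  imports "HOL-Analysis.Analysis"
begin

text \<open>
  The Euclidean surface measure on the unit sphere, defined by polar coordinates: a Borel set
  \<open>A\<close> of the sphere has measure \<open>n\<close> times the Lebesgue measure of the cone
  \<open>{r *\<^sub>R x | r x. 0 < r \<and> r < 1 \<and> x \<in> A}\<close>, where \<open>n\<close> is the dimension of the ambient space.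
  Recall that \<open>sgn x = x /\<^sub>R norm x\<close>.
\<close>

definition sphere_measure :: "'a::euclidean_space measure" where
  "sphere_measure = scale_measure (of_nat DIM('a))
     (distr (restrict_space lborel (ball 0 1 - {0})) (restrict_space borel (sphere 0 1)) sgn)"

lemma space_sphere_measure: "space (sphere_measure :: 'a::euclidean_space measure) = sphere 0 1"
  by (simp add: sphere_measure_def space_restrict_space space_scale_measure)

lemma sets_sphere_measure:
  "sets (sphere_measure :: 'a::euclidean_space measure) = sets (restrict_space borel (sphere 0 1))"
  by (simp add: sphere_measure_def)

lemma sgn_eq_iff_cone:
  fixes A :: "'a::euclidean_space set"
  assumes "A \<subseteq> sphere 0 1"
  shows "{x \<in> ball 0 1 - {0}. sgn x \<in> A} = {r *\<^sub>R x | r x. 0 < r \<and> r < 1 \<and> x \<in> A}"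
proof (intro equalityI subsetI)
  fix x assume x: "x \<in> {x \<in> ball 0 1 - {0}. sgn x \<in> A}"
  then have "x = norm x *\<^sub>R sgn x" by (simp add: sgn_div_norm)
  with x show "x \<in> {r *\<^sub>R x | r x. 0 < r \<and> r < 1 \<and> x \<in> A}"
    by (auto intro!: exI[of _ "norm x"] exI[of _ "sgn x"])
next
  fix x assume "x \<in> {r *\<^sub>R x | r x. 0 < r \<and> r < 1 \<and> x \<in> A}"
  then obtain r y where x: "x = r *\<^sub>R y" "0 < r" "r < 1" "y \<in> A" by auto
  with assms have n: "norm y = 1" by auto
  then have "sgn x = y" using x by (simp add: sgn_div_norm)
  with x n show "x \<in> {x \<in> ball 0 1 - {0}. sgn x \<in> A}" by auto
qed

lemma emeasure_sphere_measure:
  fixes A :: "'a::euclidean_space set"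
  assumes "A \<in> sets sphere_measure"
  shows "emeasure sphere_measure A =
    of_nat DIM('a) * emeasure lborel {r *\<^sub>R x | r x. 0 < r \<and> r < 1 \<and> x \<in> A}"
proof -
  let ?B = "ball 0 1 - {0} :: 'a set"
  have B: "?B \<in> sets borel" by simp
  have A: "A \<in> sets (restrict_space borel (sphere 0 1))" and sub: "A \<subseteq> sphere 0 1"
    using assms sets.sets_into_space[OF assms] by (simp_all add: sets_sphere_measure space_sphere_measure)
  have "continuous_on ?B (sgn :: 'a \<Rightarrow> 'a)"
    unfolding sgn_div_norm by (intro continuous_intros) auto
  then have "(sgn :: 'a \<Rightarrow> 'a) \<in> restrict_space borel ?B \<rightarrow>\<^sub>M borel"
    by (rule borel_measurable_continuous_on_restrict)
  then have "(sgn :: 'a \<Rightarrow> 'a) \<in> restrict_space lborel ?B \<rightarrow>\<^sub>M borel"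
    by (simp add: measurable_def sets_restrict_space space_restrict_space)
  then have m: "(sgn :: 'a \<Rightarrow> 'a) \<in> restrict_space lborel ?B \<rightarrow>\<^sub>M restrict_space borel (sphere 0 1)"
    by (intro measurable_restrict_space2) (auto simp: space_restrict_space norm_sgn)
  have "sgn -` A \<inter> space (restrict_space lborel ?B) = {x \<in> ?B. sgn x \<in> A}"
    by (auto simp: space_restrict_space)
  then show ?thesis
    unfolding sgn_eq_iff_cone[OF sub, symmetric]
    using A m B emeasure_restrict_space[of ?B lborel "{x \<in> ?B. sgn x \<in> A}"]
    by (simp add: sphere_measure_def emeasure_distr subset_iff)
qed

lemma emeasure_sphere_measure_S3:
  "emeasure (sphere_measure :: (complex \<times> complex) measure) (sphere 0 1) = ennreal (2 * pi\<^sup>2)"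
proof -
  let ?S = "sphere 0 1 :: (complex \<times> complex) set"
  have S: "?S \<in> sets sphere_measure"
    using sets.top[of "sphere_measure :: (complex \<times> complex) measure"]
    by (simp add: space_sphere_measure)
  have "{x \<in> ball 0 1 - {0}. sgn x \<in> ?S} = ball 0 1 - {0}" by (auto simp: norm_sgn)
  then have *: "{r *\<^sub>R x | r x. 0 < r \<and> r < 1 \<and> x \<in> ?S} = ball 0 1 - {0}"
    by (subst sgn_eq_iff_cone[symmetric]) auto
  have "emeasure lborel (ball 0 1 - {0} :: (complex \<times> complex) set) = ennreal (unit_ball_vol 4)"
    using emeasure_ball[of 1 "0 :: complex \<times> complex"]
    by (subst emeasure_Diff) auto
  also have "unit_ball_vol 4 = pi\<^sup>2 / 2"
    using unit_ball_vol_even[of 2] by (simp add: numeral_eq_Suc)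
  finally have "emeasure sphere_measure ?S = of_nat 4 * ennreal (pi\<^sup>2 / 2)"
    unfolding emeasure_sphere_measure[OF S] * by simp
  also have "\<dots> = ennreal (4 * (pi\<^sup>2 / 2))"
    by (subst ennreal_mult) simp_all
  finally show ?thesis by simp
qed

definition omega :: "complex \<times> complex \<Rightarrow> complex \<times> complex \<Rightarrow> complex" where
  "omega X Y = snd X * fst Y - fst X * snd Y"

text \<open>
  Only the behaviour off the null set where one of the three factors vanishes matters for the
  integral, so the convention \<open>0 powr s = 0\<close> is harmless.
\<close>

definition tau1_integrand ::
  "complex^3 \<Rightarrow> (complex \<times> complex) \<times> (complex \<times> complex) \<times> (complex \<times> complex) \<Rightarrow> complex" where
  "tau1_integrand \<mu> = (\<lambda>(x, y, z).
     of_real \<bar>Re (omega y z)\<bar> powr (- \<mu>$1 - 2) *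
     of_real \<bar>Re (omega z x)\<bar> powr (- \<mu>$2 - 2) *
     of_real \<bar>Re (omega x y)\<bar> powr (- \<mu>$3 - 2))"

definition tau1_domain :: "(complex^3) set" where
  "tau1_domain =
     {\<mu>. integrable (sphere_measure \<Otimes>\<^sub>M sphere_measure \<Otimes>\<^sub>M sphere_measure) (tau1_integrand \<mu>)}"

definition tau1_integral :: "complex^3 \<Rightarrow> complex" where
  "tau1_integral \<mu> =
     integral\<^sup>L (sphere_measure \<Otimes>\<^sub>M sphere_measure \<Otimes>\<^sub>M sphere_measure) (tau1_integrand \<mu>)"

text \<open>
  Holomorphic functions of several variables on an open set: the real Frechet derivative exists
  and is complex linear.
\<close>

definition mholomorphic_on :: "(complex^'n \<Rightarrow> complex) \<Rightarrow> (complex^'n) set \<Rightarrow> bool" where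
  "mholomorphic_on f U \<longleftrightarrow>
     (\<forall>z\<in>U. \<exists>f'. (f has_derivative f') (at z) \<and> (\<forall>c v. f' (c *s v) = c * f' v))"

text \<open>
  A meromorphic function is locally a quotient \<open>g / h\<close> of holomorphic functions with \<open>h\<close> not
  identically zero. It is represented by a total function whose values on the zero set of \<open>h\<close> are
  irrelevant; accordingly two such functions are equal as meromorphic functions if they agree,
  locally, off the zero set of a holomorphic function that is not identically zero.
\<close>

definition mmeromorphic_on :: "(complex^'n \<Rightarrow> complex) \<Rightarrow> (complex^'n) set \<Rightarrow> bool" where
  "mmeromorphic_on f S \<longleftrightarrow>
     (\<forall>p\<in>S. \<exists>U g h. open U \<and> connected U \<and> p \<in> U \<and> U \<subseteq> S \<and>
        mholomorphic_on g U \<and> mholomorphic_on h U \<and> (\<exists>z\<in>U. h z \<noteq> 0) \<and>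
        (\<forall>z\<in>U. h z \<noteq> 0 \<longrightarrow> f z = g z / h z))"

definition mmeromorphic_eq_on ::
  "(complex^'n \<Rightarrow> complex) \<Rightarrow> (complex^'n \<Rightarrow> complex) \<Rightarrow> (complex^'n) set \<Rightarrow> bool" where
  "mmeromorphic_eq_on f g S \<longleftrightarrow>
     (\<forall>p\<in>S. \<exists>U h. open U \<and> connected U \<and> p \<in> U \<and> U \<subseteq> S \<and>
        mholomorphic_on h U \<and> (\<exists>z\<in>U. h z \<noteq> 0) \<and>
        (\<forall>z\<in>U. h z \<noteq> 0 \<longrightarrow> f z = g z))"

definition meromorphic_extension_of_tau1 :: "(complex^3 \<Rightarrow> complex) \<Rightarrow> bool" where
  "meromorphic_extension_of_tau1 \<tau> \<longleftrightarrow>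
     mmeromorphic_on \<tau> UNIV \<and> (\<forall>\<mu>\<in>tau1_domain. \<tau> \<mu> = tau1_integral \<mu>)"

end

theory Submission
  imports Defs "HOL-Complex_Analysis.Complex_Analysis"
begin

text \<open>
  Write \<open>a\<^sub>j = - \<mu>\<^sub>j - 2\<close> and let \<open>P = (Re \<omega>(y, z), Re \<omega>(z, x), Re \<omega>(x, y))\<close>, so that the integrand
  is \<open>\<bar>P\<^sub>1\<bar> powr a\<^sub>1 * \<bar>P\<^sub>2\<bar> powr a\<^sub>2 * \<bar>P\<^sub>3\<bar> powr a\<^sub>3\<close>. It is homogeneous in each of \<open>x\<close>, \<open>y\<close>, \<open>z\<close>, so
  polar coordinates (\<open>nn_integral_polar\<close>) replace the three spheres by three copies of \<open>\<complex>\<^sup>2\<close>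
  carrying the Gaussian weight \<open>exp (- \<bar>x\<bar>\<^sup>2)\<close>. The price is one factor
  \<open>\<Gamma>((a\<^sub>j + a\<^sub>k + 4) / 2) / 2\<close> for each variable
  (\<open>integral_gauss_triple_homogeneous\<close>), and these are the denominators of the formula.

  Under the Gaussian weight the law of \<open>P\<close> is a mixture of centred Gaussians of \<open>\<real>\<^sup>3\<close>: it is the
  law of \<open>\<bar>h\<bar> g\<close>, where \<open>h \<in> \<complex>\<^sup>2\<close> and \<open>g \<in> \<real>\<^sup>3\<close> are independent Gaussian vectors
  (\<open>distr_omegas\<close>). For fixed \<open>x\<close>, an element of \<open>SU(2)\<close> moves \<open>x\<close> to \<open>(\<bar>x\<bar>, 0)\<close> without changing
  \<open>\<omega>\<close> or the weight; then \<open>P\<^sub>2\<close> and \<open>P\<^sub>3\<close> become \<open>\<bar>x\<bar> Re z\<^sub>2\<close> and \<open>- \<bar>x\<bar> Re y\<^sub>2\<close>, while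
  \<open>P\<^sub>1 = Re (y\<^sub>2 z\<^sub>1 - y\<^sub>1 z\<^sub>2)\<close> is, for fixed \<open>h = (y\<^sub>2, z\<^sub>2)\<close>, a linear form of norm \<open>\<bar>h\<bar>\<close> in the
  remaining Gaussian variables (\<open>nn_integral_omega_slice\<close>). Now only \<open>\<bar>h\<bar>\<close> and \<open>\<bar>x\<bar> h\<close> occur.
  Norm and direction of a Gaussian vector are independent, so \<open>\<bar>x\<bar> h\<close> may be replaced by
  \<open>\<bar>h\<bar> x\<close> (\<open>nn_integral_swap_directions\<close>). Since \<open>P\<close> has the law of \<open>\<bar>h\<bar> g\<close>, its moments are products
  of moments of independent variables, namely of \<open>\<Gamma>((a\<^sub>1 + a\<^sub>2 + a\<^sub>3 + 4) / 2)\<close> and the three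
  \<open>\<Gamma>((a\<^sub>j + 1) / 2)\<close>.

  For real exponents all of this holds for integrals with values in \<open>[0, \<infinity>]\<close>, which also determines the
  domain of absolute convergence: the integral is finite if every \<open>a\<^sub>j > -1\<close>, and it is infinite
  otherwise, because it is antitone in the exponents and the closed form blows up as an exponent
  decreases to \<open>-1\<close> (\<open>tau1_domain_iff\<close>). Hence the integral equals the right-hand side on all of
  its domain, the tube \<open>Re \<mu>\<^sub>j < -1\<close>. The right-hand side is a quotient of products of reciprocal
  Gamma functions, so it is a meromorphic continuation. It is the only one by the identity theorem for
  meromorphic functions of several variables (\<open>mmeromorphic_identity\<close>), which is reduced to
  one variable by restriction to complex lines.
\<close>

section \<open>Polar coordinates\<close>

lemma measurable_sgn [measurable]: "(sgn :: 'a::euclidean_space \<Rightarrow> 'a) \<in> borel_measurable borel"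
  unfolding sgn_div_norm by measurable

lemma nn_integral_sphere_measure:
  fixes h :: "'a::euclidean_space \<Rightarrow> ennreal"
  assumes [measurable]: "h \<in> borel_measurable borel"
  shows "(\<integral>\<^sup>+\<theta>. h \<theta> \<partial>sphere_measure) =
    of_nat DIM('a) * (\<integral>\<^sup>+x. h (sgn x) * indicator (ball 0 1 - {0}) x \<partial>lborel)"
proof -
  let ?B = "ball 0 1 - {0} :: 'a set"
  have "(sgn :: 'a \<Rightarrow> 'a) \<in> restrict_space lborel ?B \<rightarrow>\<^sub>M borel"
    by (intro measurable_restrict_space1) simp
  then have m: "(sgn :: 'a \<Rightarrow> 'a) \<in> restrict_space lborel ?B \<rightarrow>\<^sub>M restrict_space borel (sphere 0 1)"
    by (intro measurable_restrict_space2) (auto simp: space_restrict_space norm_sgn)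
  have h: "h \<in> borel_measurable (restrict_space borel (sphere 0 1))"
    by (intro measurable_restrict_space1) simp
  show ?thesis
    using m h
    by (simp add: sphere_measure_def nn_integral_scale_measure nn_integral_distr
        nn_integral_restrict_space)
qed

lemma finite_measure_sphere_measure: "finite_measure (sphere_measure :: 'a::euclidean_space measure)"
proof
  have "emeasure (sphere_measure :: 'a measure) (space sphere_measure)
      = (\<integral>\<^sup>+(\<theta>::'a). 1 \<partial>sphere_measure)"
    by simp
  also have "\<dots> = of_nat DIM('a) * (\<integral>\<^sup>+(x::'a). 1 * indicator (ball 0 1 - {0}) x \<partial>lborel)"
    by (rule nn_integral_sphere_measure) simp
  also have "\<dots> = of_nat DIM('a) * emeasure lborel (ball 0 1 - {0} :: 'a set)"
    by simp
  also have "\<dots> \<le> of_nat DIM('a) * emeasure lborel (ball 0 1 :: 'a set)"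
    by (intro mult_left_mono emeasure_mono) auto
  also have "\<dots> < \<infinity>"
    using emeasure_lborel_ball_finite[of "0::'a" 1] by (simp add: ennreal_mult_less_top of_nat_less_top)
  finally show "emeasure (sphere_measure :: 'a measure) (space sphere_measure) \<noteq> \<infinity>" by simp
qed

interpretation sphere_meas: sigma_finite_measure "sphere_measure :: 'a::euclidean_space measure"
  using finite_measure_sphere_measure finite_measure.axioms(1) by blast

lemma measurable_on_sphere_measure [measurable (raw)]:
  "f \<in> borel_measurable borel \<Longrightarrow> f \<in> borel_measurable (sphere_measure :: 'a::euclidean_space measure)"
  unfolding measurable_cong_sets[OF sets_sphere_measure refl]
  by (intro measurable_restrict_space1)

lemma nn_integral_lborel_scaleR:
  fixes f :: "'a::euclidean_space \<Rightarrow> ennreal"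
  assumes [measurable]: "f \<in> borel_measurable borel" and c: "0 < c"
  shows "ennreal (c ^ DIM('a)) * (\<integral>\<^sup>+x. f (c *\<^sub>R x) \<partial>lborel) = (\<integral>\<^sup>+x. f x \<partial>lborel)"
proof -
  have "(\<integral>\<^sup>+x. f x \<partial>lborel) =
      (\<integral>\<^sup>+x. f x \<partial>density (distr lborel borel (\<lambda>x. 0 + c *\<^sub>R x)) (\<lambda>_. \<bar>c\<bar>^DIM('a)))"
    using c by (subst lborel_affine[of c 0]) auto
  then show ?thesis
    using c by (simp add: nn_integral_density nn_integral_distr nn_integral_cmult)
qed

lemma nn_integral_inverse_power_tail:
  assumes a: "a > 0" and n: "n > 0"
  shows "(\<integral>\<^sup>+s. ennreal ((if a < s then 1 else 0) / s ^ Suc n) \<partial>lborel) = ennreal (1 / (n * a ^ n))"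
proof -
  have "(\<integral>\<^sup>+s. ennreal (1 / s ^ Suc n) * indicator {a..} s \<partial>lborel) = ennreal (0 - - 1 / (n * a ^ n))"
  proof (rule nn_integral_FTC_atLeast)
    show "((\<lambda>s. - 1 / (n * s ^ n)) has_real_derivative 1 / s ^ Suc n) (at s)" if "a \<le> s" for s
    proof -
      have "s > 0" using a that by simp
      then have "s ^ n = s * s ^ (n - 1)" using n by (cases n) auto
      with \<open>s > 0\<close> n show ?thesis
        by (auto intro!: derivative_eq_intros simp: field_simps power2_eq_square)
    qed
    show "((\<lambda>s. - 1 / (real n * s ^ n)) \<longlongrightarrow> 0) at_top"
      using n by real_asymp
  qed (use a in auto)
  moreover have "(\<integral>\<^sup>+s. ennreal ((if a < s then 1 else 0) / s ^ Suc n) \<partial>lborel) =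
      (\<integral>\<^sup>+s. ennreal (1 / s ^ Suc n) * indicator {a..} s \<partial>lborel)"
    by (intro nn_integral_cong_AE AE_I[of _ _ "{a}"]) (auto simp: indicator_def)
  ultimately show ?thesis by simp
qed

text \<open>
  The definition of the surface measure turns the inner integral over the sphere into an integral
  of \<open>f (r sgn x)\<close> over the unit ball. Substituting \<open>r = s \<bar>x\<bar>\<close> and then \<open>y = s x\<close> leaves \<open>f y\<close> times
  \<open>n \<bar>y\<bar>^n\<close> times the integral of \<open>1 / s^(n+1)\<close> over \<open>s > \<bar>y\<bar>\<close>, which is \<open>1 / (n \<bar>y\<bar>^n)\<close>.
\<close>

theorem nn_integral_polar:
  fixes f :: "'a::euclidean_space \<Rightarrow> ennreal"
  assumes [measurable]: "f \<in> borel_measurable borel"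
  shows "(\<integral>\<^sup>+x. f x \<partial>lborel) =
    (\<integral>\<^sup>+r. ennreal (indicator {0<..} r * r ^ (DIM('a) - 1)) *
       (\<integral>\<^sup>+\<theta>. f (r *\<^sub>R \<theta>) \<partial>sphere_measure) \<partial>lborel)"
proof -
  let ?n = "DIM('a)"
  define B where "B = (ball 0 1 - {0} :: 'a set)"
  have [measurable]: "B \<in> sets borel" by (simp add: B_def)
  let ?p = "\<lambda>r::real. ennreal (indicator {0<..} r * r ^ (?n - 1))"
  obtain m where m: "?n = Suc m" by (metis DIM_positive gr0_conv_Suc)
  have "(\<integral>\<^sup>+r. ?p r * (\<integral>\<^sup>+\<theta>. f (r *\<^sub>R \<theta>) \<partial>sphere_measure) \<partial>lborel) =
     (\<integral>\<^sup>+r. \<integral>\<^sup>+x. of_nat ?n * (?p r * (f (r *\<^sub>R sgn x) * indicator B x)) \<partial>lborel \<partial>lborel)"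
  proof (rule nn_integral_cong)
    fix r :: real
    have "?p r * (\<integral>\<^sup>+\<theta>. f (r *\<^sub>R \<theta>) \<partial>sphere_measure) =
        of_nat ?n * (?p r * (\<integral>\<^sup>+x. f (r *\<^sub>R sgn x) * indicator B x \<partial>lborel))"
      unfolding B_def by (subst nn_integral_sphere_measure) (simp_all only: mult_ac, measurable)
    then show "?p r * (\<integral>\<^sup>+\<theta>. f (r *\<^sub>R \<theta>) \<partial>sphere_measure) =
        (\<integral>\<^sup>+x. of_nat ?n * (?p r * (f (r *\<^sub>R sgn x) * indicator B x)) \<partial>lborel)"
      by (subst nn_integral_cmult, measurable, subst nn_integral_cmult, measurable)
  qed
  also have "\<dots> = (\<integral>\<^sup>+x. \<integral>\<^sup>+r. of_nat ?n * (?p r * (f (r *\<^sub>R sgn x) * indicator B x)) \<partial>lborel \<partial>lborel)"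
    by (rule lborel_pair.Fubini') measurable
  also have "\<dots> = (\<integral>\<^sup>+x. \<integral>\<^sup>+s. of_nat ?n * (ennreal (norm x ^ ?n) * ?p s * (f (s *\<^sub>R x) * indicator B x)) \<partial>lborel \<partial>lborel)"
  proof (rule nn_integral_cong)
    fix x :: 'a
    show "(\<integral>\<^sup>+r. of_nat ?n * (?p r * (f (r *\<^sub>R sgn x) * indicator B x)) \<partial>lborel) =
      (\<integral>\<^sup>+s. of_nat ?n * (ennreal (norm x ^ ?n) * ?p s * (f (s *\<^sub>R x) * indicator B x)) \<partial>lborel)"
    proof (cases "x = 0")
      case False
      then have x: "norm x > 0" by simp
      have "(\<integral>\<^sup>+r. of_nat ?n * (?p r * (f (r *\<^sub>R sgn x) * indicator B x)) \<partial>lborel) =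
        ennreal (norm x) * (\<integral>\<^sup>+s. of_nat ?n * (?p (norm x * s) * (f ((norm x * s) *\<^sub>R sgn x) * indicator B x)) \<partial>lborel)"
        using x by (subst nn_integral_real_affine[where c = "norm x" and t = 0]) auto
      also have "\<dots> = (\<integral>\<^sup>+s. ennreal (norm x) * (of_nat ?n * (?p (norm x * s) * (f ((norm x * s) *\<^sub>R sgn x) * indicator B x))) \<partial>lborel)"
        by (rule nn_integral_cmult[symmetric]) measurable
      also have "\<dots> = (\<integral>\<^sup>+s. of_nat ?n * (ennreal (norm x ^ ?n) * ?p s * (f (s *\<^sub>R x) * indicator B x)) \<partial>lborel)"
      proof (rule nn_integral_cong)
        fix s :: real
        have 1: "(norm x * s) *\<^sub>R sgn x = s *\<^sub>R x" using x by (simp add: sgn_div_norm)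
        have 2: "ennreal (norm x) * ?p (norm x * s) = ennreal (norm x ^ ?n) * ?p s"
          unfolding m using x
          by (auto simp: ennreal_mult'[symmetric] indicator_def power_mult_distrib zero_less_mult_iff mult_ac)
        show "ennreal (norm x) * (of_nat ?n * (?p (norm x * s) * (f ((norm x * s) *\<^sub>R sgn x) * indicator B x)))
          = of_nat ?n * (ennreal (norm x ^ ?n) * ?p s * (f (s *\<^sub>R x) * indicator B x))"
          unfolding 1 2[symmetric] by (simp only: mult_ac)
      qed
      finally show ?thesis .
    qed (simp add: B_def)
  qed
  also have "\<dots> = (\<integral>\<^sup>+s. \<integral>\<^sup>+x. of_nat ?n * (ennreal (norm x ^ ?n) * ?p s * (f (s *\<^sub>R x) * indicator B x)) \<partial>lborel \<partial>lborel)"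
    by (rule lborel_pair.Fubini') measurable
  also have "\<dots> = (\<integral>\<^sup>+s. \<integral>\<^sup>+y. of_nat ?n * (ennreal (norm y ^ ?n) * f y) * ennreal ((if norm y < s then 1 else 0) / s ^ Suc ?n) \<partial>lborel \<partial>lborel)"
    (is "_ = (\<integral>\<^sup>+s. \<integral>\<^sup>+y. ?h s y \<partial>lborel \<partial>lborel)")
  proof (rule nn_integral_cong_AE, rule AE_I[of _ _ "{0}"])
    show "{s \<in> space lborel. (\<integral>\<^sup>+x. of_nat ?n * (ennreal (norm x ^ ?n) * ?p s * (f (s *\<^sub>R x) * indicator B x)) \<partial>lborel)
        \<noteq> (\<integral>\<^sup>+y. ?h s y \<partial>lborel)} \<subseteq> {0}"
    proof (rule subsetI, rule ccontr)
      fix s :: real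
      assume A: "s \<in> {s \<in> space lborel. (\<integral>\<^sup>+x. of_nat ?n * (ennreal (norm x ^ ?n) * ?p s * (f (s *\<^sub>R x) * indicator B x)) \<partial>lborel)
        \<noteq> (\<integral>\<^sup>+y. ?h s y \<partial>lborel)}" and "s \<notin> {0}"
      then consider "s < 0" | "s > 0" by force
      then have "(\<integral>\<^sup>+x. of_nat ?n * (ennreal (norm x ^ ?n) * ?p s * (f (s *\<^sub>R x) * indicator B x)) \<partial>lborel) = (\<integral>\<^sup>+y. ?h s y \<partial>lborel)"
      proof cases
        case 1
        then have "\<not> norm y < s" for y :: 'a
          using norm_ge_zero[of y] by linarith
        with 1 show ?thesis by (simp add: indicator_def)
      next
        case 2
        have "(\<integral>\<^sup>+y. ?h s y \<partial>lborel) = ennreal (s ^ ?n) * (\<integral>\<^sup>+x. ?h s (s *\<^sub>R x) \<partial>lborel)"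
          using 2 by (subst nn_integral_lborel_scaleR) auto
        also have "\<dots> = (\<integral>\<^sup>+x. ennreal (s ^ ?n) * ?h s (s *\<^sub>R x) \<partial>lborel)"
          by (rule nn_integral_cmult[symmetric]) measurable
        also have "\<dots> = (\<integral>\<^sup>+x. of_nat ?n * (ennreal (norm x ^ ?n) * ?p s * (f (s *\<^sub>R x) * indicator B x)) \<partial>lborel)"
        proof (rule nn_integral_cong)
          fix x :: 'a
          have i: "(if norm (s *\<^sub>R x) < s then 1 else 0) = (indicator (ball 0 1) x :: real)"
            using 2 by (auto simp: indicator_def)
          have j: "ennreal (norm x ^ ?n) * indicator B x = ennreal (norm x ^ ?n * indicator (ball 0 1) x)"
             by (auto simp: indicator_def B_def)
          have "ennreal (s ^ ?n) * (ennreal (norm (s *\<^sub>R x) ^ ?n) * ennreal ((if norm (s *\<^sub>R x) < s then 1 else 0) / s ^ Suc ?n))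
             = ennreal (norm x ^ ?n * indicator (ball 0 1) x) * ?p s"
            unfolding i m using 2
            by (auto simp: ennreal_mult'[symmetric] indicator_def power_mult_distrib field_simps)
          then have "of_nat ?n * f (s *\<^sub>R x) * (ennreal (s ^ ?n) * (ennreal (norm (s *\<^sub>R x) ^ ?n) * ennreal ((if norm (s *\<^sub>R x) < s then 1 else 0) / s ^ Suc ?n)))
             = of_nat ?n * f (s *\<^sub>R x) * (ennreal (norm x ^ ?n) * indicator B x * ?p s)"
            unfolding j by simp
          then show "ennreal (s ^ ?n) * ?h s (s *\<^sub>R x) = of_nat ?n * (ennreal (norm x ^ ?n) * ?p s * (f (s *\<^sub>R x) * indicator B x))"
            by (simp only: mult_ac)
        qed
        finally show ?thesis by simp
      qed
      with A show False by blast
    qed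
  qed auto
  also have "\<dots> = (\<integral>\<^sup>+y. \<integral>\<^sup>+s. ?h s y \<partial>lborel \<partial>lborel)"
    by (rule lborel_pair.Fubini') measurable
  also have "\<dots> = (\<integral>\<^sup>+y. f y \<partial>lborel)"
  proof (rule nn_integral_cong_AE, rule AE_I[of _ _ "{0}"])
    show "{y \<in> space lborel. (\<integral>\<^sup>+s. ?h s y \<partial>lborel) \<noteq> f y} \<subseteq> {0}"
    proof (rule subsetI, rule ccontr)
      fix y :: 'a
      assume A: "y \<in> {y \<in> space lborel. (\<integral>\<^sup>+s. ?h s y \<partial>lborel) \<noteq> f y}" and "y \<notin> {0}"
      then have y: "norm y > 0" by simp
      have "(\<integral>\<^sup>+s. ?h s y \<partial>lborel) = of_nat ?n * (ennreal (norm y ^ ?n) * f y) *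
          ennreal (1 / (?n * norm y ^ ?n))"
        using y by (subst nn_integral_cmult) (auto simp: nn_integral_inverse_power_tail[of "norm y" ?n, simplified])
      also have "\<dots> = (ennreal (real ?n) * (ennreal (norm y ^ ?n) * ennreal (1 / (?n * norm y ^ ?n)))) * f y"
        by (simp add: mult_ac ennreal_of_nat_eq_real_of_nat)
      also have "ennreal (real ?n) * (ennreal (norm y ^ ?n) * ennreal (1 / (?n * norm y ^ ?n))) = 1"
        using y by (simp flip: ennreal_mult')
      finally show False using A by simp
    qed
  qed auto
  finally show ?thesis by simp
qed

lemma measurable_sphere_measureD [measurable_dest]:
  assumes "f \<in> M \<rightarrow>\<^sub>M (sphere_measure :: 'a::euclidean_space measure)"
  shows "f \<in> borel_measurable M"
proof -
  have "(\<lambda>x. x) \<in> borel_measurable (sphere_measure :: 'a measure)" by measurable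
  from measurable_compose[OF assms this] show ?thesis by simp
qed

section \<open>The Gaussian measure in polar coordinates\<close>

definition gauss :: "'a::euclidean_space measure" where
  "gauss = density lborel (\<lambda>x. ennreal (exp (- (norm x)\<^sup>2)))"

definition radial :: "nat \<Rightarrow> real measure" where
  "radial n = density lborel (\<lambda>r. ennreal (indicator {0<..} r * r ^ (n - 1) * exp (- r\<^sup>2)))"

lemma sets_gauss [measurable_cong, simp]: "sets gauss = sets borel"
  and space_gauss [simp]: "space gauss = UNIV"
  by (simp_all add: gauss_def)

lemma sets_radial [measurable_cong, simp]: "sets (radial n) = sets borel"
  and space_radial [simp]: "space (radial n) = UNIV"
  by (simp_all add: radial_def)

interpretation gauss: sigma_finite_measure "gauss :: 'a::euclidean_space measure"
  unfolding gauss_def by (subst sigma_finite_measure.sigma_finite_iff_density_finite[OF sigma_finite_lborel]) auto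

interpretation radial: sigma_finite_measure "radial n" for n
  unfolding radial_def by (subst sigma_finite_measure.sigma_finite_iff_density_finite[OF sigma_finite_lborel]) auto

interpretation gauss_pair: pair_sigma_finite "gauss :: 'a::euclidean_space measure" "gauss :: 'b::euclidean_space measure" ..
interpretation radial_sphere: pair_sigma_finite "radial n" "sphere_measure :: 'a::euclidean_space measure" for n ..

lemma AE_radial_pos: "AE r in radial n. r > 0"
  unfolding radial_def by (subst AE_density) (auto simp: indicator_def)

lemma nn_integral_gauss_polar:
  fixes f :: "'a::euclidean_space \<Rightarrow> ennreal"
  assumes [measurable]: "f \<in> borel_measurable borel"
  shows "(\<integral>\<^sup>+x. f x \<partial>gauss) =
    (\<integral>\<^sup>+r. \<integral>\<^sup>+\<theta>. f (r *\<^sub>R \<theta>) \<partial>sphere_measure \<partial>radial DIM('a))"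
proof -
  let ?p = "\<lambda>r::real. indicator {0<..} r * r ^ (DIM('a) - 1)"
  have "(\<integral>\<^sup>+x. f x \<partial>gauss) = (\<integral>\<^sup>+x. ennreal (exp (- (norm x)\<^sup>2)) * f x \<partial>lborel)"
    by (simp add: gauss_def nn_integral_density)
  also have "\<dots> = (\<integral>\<^sup>+r. ennreal (?p r) * (\<integral>\<^sup>+\<theta>. ennreal (exp (- (norm (r *\<^sub>R \<theta>))\<^sup>2)) * f (r *\<^sub>R \<theta>) \<partial>sphere_measure) \<partial>lborel)"
    by (rule nn_integral_polar) measurable
  also have "\<dots> = (\<integral>\<^sup>+r. ennreal (?p r * exp (- r\<^sup>2)) * (\<integral>\<^sup>+\<theta>. f (r *\<^sub>R \<theta>) \<partial>sphere_measure) \<partial>lborel)"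
  proof (rule nn_integral_cong)
    fix r :: real
    have "(\<integral>\<^sup>+\<theta>. ennreal (exp (- (norm (r *\<^sub>R \<theta> :: 'a))\<^sup>2)) * f (r *\<^sub>R \<theta>) \<partial>sphere_measure)
        = (\<integral>\<^sup>+\<theta>. ennreal (exp (- r\<^sup>2)) * f (r *\<^sub>R \<theta>) \<partial>sphere_measure)"
      by (rule nn_integral_cong) (simp add: space_sphere_measure)
    also have "\<dots> = ennreal (exp (- r\<^sup>2)) * (\<integral>\<^sup>+\<theta>. f (r *\<^sub>R \<theta>) \<partial>sphere_measure)"
      by (rule nn_integral_cmult) measurable
    finally show "ennreal (?p r) * (\<integral>\<^sup>+\<theta>. ennreal (exp (- (norm (r *\<^sub>R \<theta> :: 'a))\<^sup>2)) * f (r *\<^sub>R \<theta>) \<partial>sphere_measure) =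
        ennreal (?p r * exp (- r\<^sup>2)) * (\<integral>\<^sup>+\<theta>. f (r *\<^sub>R \<theta>) \<partial>sphere_measure)"
      by (simp only: ennreal_mult''[OF exp_ge_zero]) (simp only: mult.assoc)
  qed
  also have "\<dots> = (\<integral>\<^sup>+r. \<integral>\<^sup>+\<theta>. f (r *\<^sub>R \<theta>) \<partial>sphere_measure \<partial>radial DIM('a))"
    unfolding radial_def by (subst nn_integral_density) simp_all
  finally show ?thesis .
qed

lemma gauss_polar:
  "(gauss :: 'a::euclidean_space measure) =
     distr (radial DIM('a) \<Otimes>\<^sub>M sphere_measure) borel (\<lambda>(r, \<theta>). r *\<^sub>R \<theta>)"
proof (rule measure_eqI)
  fix A :: "'a set" assume "A \<in> sets gauss"
  then have [measurable]: "A \<in> sets borel" by simp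
  have "emeasure gauss A = (\<integral>\<^sup>+x. indicator A x \<partial>gauss)" by simp
  also have "\<dots> = (\<integral>\<^sup>+r. \<integral>\<^sup>+\<theta>. indicator A (r *\<^sub>R \<theta>) \<partial>sphere_measure \<partial>radial DIM('a))"
    by (rule nn_integral_gauss_polar) measurable
  also have "\<dots> = (\<integral>\<^sup>+p. indicator A (fst p *\<^sub>R snd p) \<partial>(radial DIM('a) \<Otimes>\<^sub>M sphere_measure))"
    by (subst sphere_meas.nn_integral_fst[symmetric]) simp_all
  also have "\<dots> = (\<integral>\<^sup>+x. indicator A x \<partial>distr (radial DIM('a) \<Otimes>\<^sub>M sphere_measure) borel (\<lambda>(r, \<theta>). r *\<^sub>R \<theta>))"
    by (subst nn_integral_distr) (simp_all add: split_beta')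
  finally show "emeasure gauss A = emeasure (distr (radial DIM('a) \<Otimes>\<^sub>M sphere_measure) borel (\<lambda>(r, \<theta>). r *\<^sub>R \<theta>)) A"
    by simp
qed simp

text \<open>
  In polar coordinates \<open>h = t \<theta>\<close> and \<open>x = r \<eta>\<close> the two sides contain \<open>F (t, r t \<theta>)\<close> and
  \<open>F (t, r t \<eta>)\<close>. Both directions are distributed by the same measure, independently of
  \<open>t\<close> and \<open>r\<close>, so \<open>\<theta>\<close> and \<open>\<eta>\<close> may be exchanged.
\<close>

lemma nn_integral_swap_directions:
  fixes F :: "real \<times> 'a::euclidean_space \<Rightarrow> ennreal"
  assumes [measurable]: "F \<in> borel_measurable borel"
  shows "(\<integral>\<^sup>+h. \<integral>\<^sup>+x. F (norm h, norm x *\<^sub>R h) \<partial>(gauss :: 'a measure) \<partial>(gauss :: 'a measure)) =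
         (\<integral>\<^sup>+h. \<integral>\<^sup>+x. F (norm h, norm h *\<^sub>R x) \<partial>gauss \<partial>(gauss :: 'a measure))"
proof -
  let ?S = "sphere_measure :: 'a measure" and ?R = "radial DIM('a)"
  have A: "(\<integral>\<^sup>+h. \<integral>\<^sup>+x. F (norm h, norm x *\<^sub>R h) \<partial>(gauss :: 'a measure) \<partial>(gauss :: 'a measure)) =
    (\<integral>\<^sup>+t. \<integral>\<^sup>+\<theta>. \<integral>\<^sup>+r. \<integral>\<^sup>+\<eta>. F (t, (r * t) *\<^sub>R \<theta>) \<partial>?S \<partial>?R \<partial>?S \<partial>?R)"
  proof (subst nn_integral_gauss_polar)
    have "(\<integral>\<^sup>+x. F (norm (t *\<^sub>R \<theta>), norm x *\<^sub>R t *\<^sub>R \<theta>) \<partial>(gauss :: 'a measure)) =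
        (\<integral>\<^sup>+r. \<integral>\<^sup>+\<eta>. F (t, (r * t) *\<^sub>R \<theta>) \<partial>?S \<partial>?R)" if "t > 0" "\<theta> \<in> sphere 0 1" for t and \<theta> :: 'a
    proof (subst nn_integral_gauss_polar)
      show "(\<integral>\<^sup>+r. \<integral>\<^sup>+\<eta>. F (norm (t *\<^sub>R \<theta>), norm (r *\<^sub>R \<eta> :: 'a) *\<^sub>R t *\<^sub>R \<theta>) \<partial>?S \<partial>?R) =
        (\<integral>\<^sup>+r. \<integral>\<^sup>+\<eta>. F (t, (r * t) *\<^sub>R \<theta>) \<partial>?S \<partial>?R)"
      proof (rule nn_integral_cong_AE, rule eventually_mono[OF AE_radial_pos], rule nn_integral_cong)
        fix r :: real and \<eta> :: 'a assume "r > 0" "\<eta> \<in> space ?S"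
        with that show "F (norm (t *\<^sub>R \<theta>), norm (r *\<^sub>R \<eta>) *\<^sub>R t *\<^sub>R \<theta>) = F (t, (r * t) *\<^sub>R \<theta>)"
          by (simp add: space_sphere_measure)
      qed
    qed measurable
    then show "(\<integral>\<^sup>+t. \<integral>\<^sup>+\<theta>. \<integral>\<^sup>+x. F (norm (t *\<^sub>R \<theta>), norm x *\<^sub>R t *\<^sub>R \<theta>) \<partial>(gauss :: 'a measure) \<partial>?S \<partial>?R)
      = (\<integral>\<^sup>+t. \<integral>\<^sup>+\<theta>. \<integral>\<^sup>+r. \<integral>\<^sup>+\<eta>. F (t, (r * t) *\<^sub>R \<theta>) \<partial>?S \<partial>?R \<partial>?S \<partial>?R)"
      by (intro nn_integral_cong_AE eventually_mono[OF AE_radial_pos] nn_integral_cong)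
         (simp add: space_sphere_measure)
  qed measurable
  have B: "(\<integral>\<^sup>+h. \<integral>\<^sup>+x. F (norm h, norm h *\<^sub>R x) \<partial>gauss \<partial>(gauss :: 'a measure)) =
    (\<integral>\<^sup>+t. \<integral>\<^sup>+\<theta>. \<integral>\<^sup>+r. \<integral>\<^sup>+\<eta>. F (t, (r * t) *\<^sub>R \<eta>) \<partial>?S \<partial>?R \<partial>?S \<partial>?R)"
  proof (subst nn_integral_gauss_polar)
    have "(\<integral>\<^sup>+x. F (norm (t *\<^sub>R \<theta>), norm (t *\<^sub>R \<theta>) *\<^sub>R x) \<partial>(gauss :: 'a measure)) =
        (\<integral>\<^sup>+r. \<integral>\<^sup>+\<eta>. F (t, (r * t) *\<^sub>R \<eta>) \<partial>?S \<partial>?R)" if "t > 0" "\<theta> \<in> sphere 0 1" for t and \<theta> :: 'a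
      using that
      by (subst nn_integral_gauss_polar, measurable) (simp add: mult.commute)
    then show "(\<integral>\<^sup>+t. \<integral>\<^sup>+\<theta>. \<integral>\<^sup>+x. F (norm (t *\<^sub>R \<theta>), norm (t *\<^sub>R \<theta>) *\<^sub>R x) \<partial>(gauss :: 'a measure) \<partial>?S \<partial>?R)
      = (\<integral>\<^sup>+t. \<integral>\<^sup>+\<theta>. \<integral>\<^sup>+r. \<integral>\<^sup>+\<eta>. F (t, (r * t) *\<^sub>R \<eta>) \<partial>?S \<partial>?R \<partial>?S \<partial>?R)"
      by (intro nn_integral_cong_AE eventually_mono[OF AE_radial_pos] nn_integral_cong)
         (simp add: space_sphere_measure)
  qed measurable
  have "(\<integral>\<^sup>+\<theta>. \<integral>\<^sup>+r. \<integral>\<^sup>+\<eta>. F (t, (r * t) *\<^sub>R \<theta>) \<partial>?S \<partial>?R \<partial>?S) =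
      (\<integral>\<^sup>+\<theta>. \<integral>\<^sup>+r. \<integral>\<^sup>+\<eta>. F (t, (r * t) *\<^sub>R \<eta>) \<partial>?S \<partial>?R \<partial>?S)" for t
  proof -
    have "(\<integral>\<^sup>+\<theta>. \<integral>\<^sup>+r. \<integral>\<^sup>+\<eta>. F (t, (r * t) *\<^sub>R \<theta>) \<partial>?S \<partial>?R \<partial>?S) =
      (\<integral>\<^sup>+r. \<integral>\<^sup>+\<theta>. F (t, (r * t) *\<^sub>R \<theta>) * emeasure ?S (space ?S) \<partial>?S \<partial>?R)"
      by (subst radial_sphere.Fubini') (simp_all, measurable)
    also have "\<dots> = (\<integral>\<^sup>+r. (\<integral>\<^sup>+\<theta>. F (t, (r * t) *\<^sub>R \<theta>) \<partial>?S) * emeasure ?S (space ?S) \<partial>?R)"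
      by (subst nn_integral_multc) (simp_all, measurable)
    also have "\<dots> = (\<integral>\<^sup>+r. (\<integral>\<^sup>+\<theta>. F (t, (r * t) *\<^sub>R \<theta>) \<partial>?S) \<partial>?R) * emeasure ?S (space ?S)"
      by (subst nn_integral_multc) (simp_all, measurable)
    finally show ?thesis by simp
  qed
  then show ?thesis unfolding A B by simp
qed

section \<open>Gamma integrals and homogeneous functions\<close>

text \<open>
  The substitution \<open>t = r\<^sup>2\<close> on the half line, as an identity of measures: in this form it serves
  nonnegative and complex integrands alike.
\<close>

lemma distr_square_lborel:
  "distr (density lborel (\<lambda>r. ennreal (indicator {0<..} r * (2 * r)))) borel (\<lambda>r. r\<^sup>2) =
     density lborel (\<lambda>t::real. ennreal (indicator {0<..} t))" (is "?M = ?N")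
proof (rule measure_eqI)
  fix A assume "A \<in> sets ?M"
  then have [measurable]: "A \<in> sets borel" by simp
  define B where "B n = A \<inter> {..(real n)\<^sup>2}" for n
  have [measurable]: "B n \<in> sets borel" for n by (simp add: B_def)
  have [measurable]: "(\<lambda>r. r\<^sup>2) -` B n \<in> sets borel" for n
    by (rule measurable_sets_borel) measurable
  have eq: "emeasure ?M (B n) = emeasure ?N (B n)" for n
  proof -
    have "emeasure ?N (B n) = (\<integral>\<^sup>+t. ennreal (indicator {0<..} t) * indicator (B n) t \<partial>lborel)"
      by (rule emeasure_density) simp_all
    also have "\<dots> = (\<integral>\<^sup>+t. ennreal (indicator (B n) t * indicator {0^2..(real n)^2} t) \<partial>lborel)"
      by (intro nn_integral_cong_AE AE_I[of _ _ "{0}"]) (auto simp: indicator_def B_def)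
    also have "\<dots> = (\<integral>\<^sup>+r. ennreal (indicator (B n) (r^2) * (2 * r) * indicator {0..real n} r) \<partial>lborel)"
      by (rule nn_integral_substitution[where g = "\<lambda>r. r^2"])
         (auto intro!: derivative_eq_intros continuous_intros simp: set_borel_measurable_def)
    also have "\<dots> = (\<integral>\<^sup>+r. ennreal (indicator {0<..} r * (2 * r)) * indicator (B n) (r^2) \<partial>lborel)"
      by (intro nn_integral_cong) (auto simp: indicator_def B_def power2_le_iff_abs_le)
    also have "\<dots> = emeasure ?M (B n)"
      by (subst emeasure_distr, simp, simp, subst emeasure_density) (auto simp: indicator_def)
    finally show ?thesis by simp
  qed
  have inc: "incseq B"
    by (auto simp: incseq_def B_def intro: order_trans power_mono)
  have un: "(\<Union>n. B n) = A"
  proof -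
    have "\<exists>n. x \<le> (real n)\<^sup>2" for x :: real
    proof -
      obtain n where n: "x \<le> real n" using real_arch_simple by blast
      also have "real n \<le> (real n)\<^sup>2" by (cases n) (auto simp: power2_eq_square)
      finally show ?thesis by blast
    qed
    then show ?thesis by (auto simp: B_def)
  qed
  have "emeasure ?M A = (SUP n. emeasure ?M (B n))"
    using SUP_emeasure_incseq[of B ?M] inc un by (simp add: image_subset_iff)
  also have "\<dots> = emeasure ?N A"
    unfolding eq using SUP_emeasure_incseq[of B ?N] inc un by (simp add: image_subset_iff)
  finally show "emeasure ?M A = emeasure ?N A" .
qed simp

lemma nn_integral_powr_gauss_real:
  assumes "c > 0"
  shows "(\<integral>\<^sup>+r. ennreal (indicator {0<..} r * (r powr (c - 1) * exp (- r\<^sup>2))) \<partial>lborel) =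
    ennreal (Gamma (c / 2) / 2)"
proof -
  let ?h = "\<lambda>t::real. ennreal (indicator {0<..} t * (t powr (c / 2 - 1) / exp t / 2))"
  have "(\<integral>\<^sup>+r. ennreal (indicator {0<..} r * (r powr (c - 1) * exp (- r\<^sup>2))) \<partial>lborel) =
      (\<integral>\<^sup>+r. ennreal (indicator {0<..} r * (2 * r)) * ?h (r\<^sup>2) \<partial>lborel)"
  proof (rule nn_integral_cong)
    fix r :: real
    have "r powr (c - 1) = 2 * r * ((r\<^sup>2) powr (c / 2 - 1) / 2)" if "r > 0"
    proof -
      have "r powr (c - 1) = r powr (1 + 2 * (c / 2 - 1))" by simp
      also have "\<dots> = r * (r\<^sup>2) powr (c / 2 - 1)"
        using that powr_powr[of r 2 "c / 2 - 1"] by (subst powr_add) simp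
      finally show ?thesis by simp
    qed
    then show "ennreal (indicator {0<..} r * (r powr (c - 1) * exp (- r\<^sup>2))) =
      ennreal (indicator {0<..} r * (2 * r)) * ?h (r\<^sup>2)"
      by (auto simp: indicator_def exp_minus field_simps simp flip: ennreal_mult')
  qed
  also have "\<dots> = (\<integral>\<^sup>+t. ?h t \<partial>distr (density lborel (\<lambda>r. ennreal (indicator {0<..} r * (2 * r)))) borel (\<lambda>r. r\<^sup>2))"
    by (simp add: nn_integral_distr nn_integral_density)
  also have "\<dots> = (\<integral>\<^sup>+t. ennreal (indicator {0<..} t) * ?h t \<partial>lborel)"
    unfolding distr_square_lborel by (simp add: nn_integral_density)
  also have "\<dots> = (\<integral>\<^sup>+t. ennreal (indicator {0..} t * t powr (c / 2 - 1) / exp t) * ennreal (1 / 2) \<partial>lborel)"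
    by (subst ennreal_mult''[symmetric], simp)
       (intro nn_integral_cong_AE AE_I[of _ _ "{0}"], auto simp: indicator_def)
  also have "\<dots> = (\<integral>\<^sup>+t. ennreal (indicator {0..} t * t powr (c / 2 - 1) / exp t) \<partial>lborel) * ennreal (1 / 2)"
    by (rule nn_integral_multc) measurable
  also have "\<dots> = ennreal (Gamma (c / 2) / 2)"
    using assms by (subst Gamma_conv_nn_integral_real[symmetric], simp, subst ennreal_mult''[symmetric]) auto
  finally show ?thesis .
qed

lemma integral_powr_gauss_complex:
  assumes "Re c > 0"
  shows "(LINT r|lborel. indicator {0<..} r *\<^sub>R (of_real r powr (c - 1) * of_real (exp (- r\<^sup>2)))) =
    Gamma (c / 2) / 2"
proof -
  let ?h = "\<lambda>t::real. indicator {0<..} t *\<^sub>R (of_real t powr (c / 2 - 1) / of_real (exp t)) / 2 :: complex"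
  have "(LINT r|lborel. indicator {0<..} r *\<^sub>R (of_real r powr (c - 1) * of_real (exp (- r\<^sup>2)))) =
      (LINT r|lborel. (indicator {0<..} r * (2 * r)) *\<^sub>R ?h (r\<^sup>2))"
  proof (rule Bochner_Integration.integral_cong)
    fix r :: real
    have "(of_real r :: complex) powr (c - 1) = 2 * of_real r * ((of_real (r\<^sup>2)) powr (c / 2 - 1) / 2)" if "r > 0"
    proof -
      have "(of_real r :: complex) powr (c - 1) = of_real r powr (1 + 2 * (c / 2 - 1))" by simp
      also have "\<dots> = of_real r * (of_real r powr (2 * (c / 2 - 1)))"
        using that by (subst powr_add) simp
      also have "of_real r powr (2 * (c / 2 - 1)) = (of_real (r\<^sup>2) :: complex) powr (c / 2 - 1)"
        using that by (simp add: powr_def ln_realpow Ln_of_real field_simps flip: of_real_power)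
      finally show ?thesis by simp
    qed
    then show "indicator {0<..} r *\<^sub>R (of_real r powr (c - 1) * of_real (exp (- r\<^sup>2))) =
      (indicator {0<..} r * (2 * r)) *\<^sub>R ?h (r\<^sup>2)"
      by (auto simp: indicator_def exp_minus field_simps scaleR_conv_of_real)
  qed simp
  also have "\<dots> = (LINT t|distr (density lborel (\<lambda>r. ennreal (indicator {0<..} r * (2 * r)))) borel (\<lambda>r. r\<^sup>2). ?h t)"
    by (subst integral_distr, simp, simp, subst integral_density) (auto intro!: AE_I2 simp: indicator_def)
  also have "\<dots> = (LINT t|lborel. indicator {0<..} t *\<^sub>R ?h t)"
    unfolding distr_square_lborel by (subst integral_density) auto
  also have "\<dots> = (LINT t|lborel. indicator {0<..} t *\<^sub>R (of_real t powr (c / 2 - 1) / of_real (exp t))) / 2"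
    by (subst integral_divide_zero[symmetric], rule Bochner_Integration.integral_cong) (auto simp: indicator_def)
  also have "(LINT t|lborel. indicator {0<..} t *\<^sub>R ((of_real t :: complex) powr (c / 2 - 1) / of_real (exp t))) =
      (LINT t|lebesgue. indicator {0<..} t *\<^sub>R (of_real t powr (c / 2 - 1) / of_real (exp t)))"
    by (rule integral_completion[symmetric]) measurable
  also have "\<dots> = Gamma (c / 2)"
    using set_lebesgue_integral_eq_integral(2)[OF absolutely_integrable_Gamma_integral'[of "c / 2"]]
      Gamma_integral_complex'[of "c / 2"] assms
    by (simp add: set_lebesgue_integral_def integral_unique)
  finally show ?thesis .
qed

lemma nn_integral_radial_powr:
  assumes "k + real n > 0" "n > 0"
  shows "(\<integral>\<^sup>+r. ennreal (r powr k) \<partial>radial n) = ennreal (Gamma ((k + real n) / 2) / 2)"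
proof -
  have "(\<integral>\<^sup>+r. ennreal (r powr k) \<partial>radial n) =
    (\<integral>\<^sup>+r. ennreal (indicator {0<..} r * r ^ (n - 1) * exp (- r\<^sup>2)) * ennreal (r powr k) \<partial>lborel)"
    unfolding radial_def by (rule nn_integral_density) measurable
  also have "\<dots> = (\<integral>\<^sup>+r. ennreal (indicator {0<..} r * (r powr (k + real n - 1) * exp (- r\<^sup>2))) \<partial>lborel)"
  proof (rule nn_integral_cong)
    fix r :: real
    have "r ^ (n - 1) * r powr k = r powr (k + real n - 1)" if "r > 0"
      using that assms by (simp add: powr_realpow[symmetric] powr_add[symmetric] of_nat_diff algebra_simps)
    then show "ennreal (indicator {0<..} r * r ^ (n - 1) * exp (- r\<^sup>2)) * ennreal (r powr k) =
        ennreal (indicator {0<..} r * (r powr (k + real n - 1) * exp (- r\<^sup>2)))"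
      by (auto simp: indicator_def mult_ac simp flip: ennreal_mult')
  qed
  finally show ?thesis using assms nn_integral_powr_gauss_real[of "k + real n"] by simp
qed

lemma integral_radial_powr:
  assumes "Re k + real n > 0" "n > 0"
  shows "(LINT r|radial n. of_real r powr k) = Gamma ((k + of_nat n) / 2) / (2 :: complex)"
proof -
  have "(LINT r|radial n. (of_real r :: complex) powr k) =
    (LINT r|lborel. (indicator {0<..} r * r ^ (n - 1) * exp (- r\<^sup>2)) *\<^sub>R of_real r powr k)"
    unfolding radial_def by (rule integral_density) (auto simp: indicator_def)
  also have "\<dots> = (LINT r|lborel. indicator {0<..} r *\<^sub>R (of_real r powr (k + of_nat n - 1) * of_real (exp (- r\<^sup>2))))"
  proof (rule Bochner_Integration.integral_cong)
    fix r :: real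
    have "of_real (r ^ (n - 1)) * of_real r powr k = (of_real r :: complex) powr (k + of_nat n - 1)" if "r > 0"
    proof -
      have "(of_real r :: complex) powr (k + of_nat n - 1) = of_real r powr (of_nat (n - 1) + k)"
        using assms by (simp add: of_nat_diff algebra_simps)
      also have "\<dots> = of_real r ^ (n - 1) * of_real r powr k"
        using that by (subst powr_add) (simp add: powr_nat')
      finally show ?thesis by simp
    qed
    then show "(indicator {0<..} r * r ^ (n - 1) * exp (- r\<^sup>2)) *\<^sub>R (of_real r :: complex) powr k =
        indicator {0<..} r *\<^sub>R (of_real r powr (k + of_nat n - 1) * of_real (exp (- r\<^sup>2)))"
      by (auto simp: indicator_def scaleR_conv_of_real mult_ac)
  qed simp
  finally show ?thesis using assms integral_powr_gauss_complex[of "k + of_nat n"] by simp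
qed

text \<open>
  A homogeneous function separates in polar coordinates, and the radial integral is a Gamma value.
  This passes from the Gaussian weight to the surface measure and back.
\<close>

lemma nn_integral_gauss_homogeneous:
  fixes h :: "'a::euclidean_space \<Rightarrow> ennreal"
  assumes [measurable]: "h \<in> borel_measurable borel"
    and hom: "\<And>r x. r > 0 \<Longrightarrow> h (r *\<^sub>R x) = ennreal (r powr k) * h x"
    and k: "k + DIM('a) > 0"
  shows "(\<integral>\<^sup>+x. h x \<partial>gauss) = ennreal (Gamma ((k + DIM('a)) / 2) / 2) * (\<integral>\<^sup>+x. h x \<partial>sphere_measure)"
proof -
  have "(\<integral>\<^sup>+x. h x \<partial>gauss) =
      (\<integral>\<^sup>+r. \<integral>\<^sup>+\<theta>. h (r *\<^sub>R \<theta>) \<partial>sphere_measure \<partial>radial DIM('a))"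
    by (rule nn_integral_gauss_polar) measurable
  also have "\<dots> = (\<integral>\<^sup>+r. ennreal (r powr k) * (\<integral>\<^sup>+\<theta>. h \<theta> \<partial>sphere_measure) \<partial>radial DIM('a))"
    by (intro nn_integral_cong_AE eventually_mono[OF AE_radial_pos])
       (simp add: hom nn_integral_cmult measurable_on_sphere_measure)
  also have "\<dots> = ennreal (Gamma ((k + DIM('a)) / 2) / 2) * (\<integral>\<^sup>+x. h x \<partial>sphere_measure)"
    using k by (subst nn_integral_multc) (simp_all add: nn_integral_radial_powr)
  finally show ?thesis .
qed

text \<open>
  By the nonnegative version, applied to the norm,
  \<open>h\<close> is integrable for both measures or for neither, and in the second case both Bochner integrals
  are \<open>0\<close> by convention.
\<close>

lemma integral_gauss_homogeneous:
  fixes h :: "'a::euclidean_space \<Rightarrow> complex"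
  assumes [measurable]: "h \<in> borel_measurable borel"
    and hom: "\<And>r x. r > 0 \<Longrightarrow> h (r *\<^sub>R x) = of_real r powr k * h x"
    and k: "Re k + DIM('a) > 0"
  shows "(LINT x|gauss. h x) = Gamma ((k + of_nat DIM('a)) / 2) / 2 * (LINT x|sphere_measure. h x)"
proof -
  have nn: "(\<integral>\<^sup>+x. norm (h x) \<partial>gauss) =
      ennreal (Gamma ((Re k + DIM('a)) / 2) / 2) * (\<integral>\<^sup>+x. norm (h x) \<partial>sphere_measure)"
    using k by (intro nn_integral_gauss_homogeneous)
      (auto simp: hom norm_mult norm_powr_real_powr ennreal_mult')
  have pos: "Gamma ((Re k + DIM('a)) / 2) > 0"
    using k by (intro Gamma_real_pos) auto
  have [measurable]: "h \<in> borel_measurable sphere_measure" by (rule measurable_on_sphere_measure) simp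
  have iff: "integrable gauss h \<longleftrightarrow> integrable sphere_measure h"
    using pos by (auto simp: integrable_iff_bounded nn ennreal_mult_less_top zero_less_mult_iff)
  show ?thesis
  proof (cases "integrable gauss h")
    case True
    let ?P = "radial DIM('a) \<Otimes>\<^sub>M (sphere_measure :: 'a measure)"
    have "integrable (distr ?P borel (\<lambda>(r, \<theta>). r *\<^sub>R \<theta>)) h"
      using True by (simp flip: gauss_polar)
    then have int: "integrable ?P (\<lambda>p. h (case p of (r, \<theta>) \<Rightarrow> r *\<^sub>R \<theta>))"
      by (subst (asm) integrable_distr_eq) auto
    have "(LINT x|gauss. h x) = (LINT p|?P. h (case p of (r, \<theta>) \<Rightarrow> r *\<^sub>R \<theta>))"
      by (subst gauss_polar, rule integral_distr) auto
    also have "\<dots> = (LINT r|radial DIM('a). LINT \<theta>|sphere_measure. h (r *\<^sub>R \<theta>))"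
      using radial_sphere.integral_fst'[OF int] by simp
    also have "\<dots> = (LINT r|radial DIM('a). of_real r powr k * (LINT \<theta>|sphere_measure. h \<theta>))"
    proof (intro integral_cong_AE eventually_mono[OF AE_radial_pos])
      have [measurable]: "(\<lambda>r. LINT \<theta>|sphere_measure. h (r *\<^sub>R \<theta>)) \<in> borel_measurable (radial DIM('a))"
        by (rule sphere_meas.borel_measurable_lebesgue_integral) measurable
      show "(\<lambda>r. LINT \<theta>|sphere_measure. h (r *\<^sub>R \<theta>)) \<in> borel_measurable (radial DIM('a))" by measurable
    qed (auto simp: hom)
    also have "\<dots> = Gamma ((k + of_nat DIM('a)) / 2) / 2 * (LINT x|sphere_measure. h x)"
      using k by (simp add: integral_radial_powr)
    finally show ?thesis .
  next
    case False
    then show ?thesis using iff by (simp add: not_integrable_integral_eq)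
  qed
qed

section \<open>Product structure of the Gaussian measure\<close>

lemma borel_measurable_fst_snd [measurable (raw)]:
  fixes f :: "'c \<Rightarrow> 'a::second_countable_topology \<times> 'b::second_countable_topology"
  assumes "f \<in> borel_measurable M"
  shows "(\<lambda>x. fst (f x)) \<in> borel_measurable M" "(\<lambda>x. snd (f x)) \<in> borel_measurable M"
  using assms by (auto simp: borel_prod[symmetric])

lemma nn_integral_lborel_translate:
  fixes f :: "'a::euclidean_space \<Rightarrow> ennreal"
  assumes [measurable]: "f \<in> borel_measurable borel"
  shows "(\<integral>\<^sup>+x. f (c + x) \<partial>lborel) = (\<integral>\<^sup>+x. f x \<partial>lborel)"
proof -
  have "(\<integral>\<^sup>+x. f x \<partial>lborel) = (\<integral>\<^sup>+x. f x \<partial>distr lborel borel ((+) c))"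
    by (simp only: lborel_distr_plus)
  also have "\<dots> = (\<integral>\<^sup>+x. f (c + x) \<partial>lborel)"
    by (subst nn_integral_distr) auto
  finally show ?thesis ..
qed

lemma nn_integral_lborel_Pair:
  fixes f :: "'a::euclidean_space \<times> 'b::euclidean_space \<Rightarrow> ennreal"
  assumes [measurable]: "f \<in> borel_measurable borel"
  shows "(\<integral>\<^sup>+p. f p \<partial>lborel) = (\<integral>\<^sup>+x. \<integral>\<^sup>+y. f (x, y) \<partial>lborel \<partial>lborel)"
    and "(\<integral>\<^sup>+p. f p \<partial>lborel) = (\<integral>\<^sup>+y. \<integral>\<^sup>+x. f (x, y) \<partial>lborel \<partial>lborel)"
proof -
  have m: "f \<in> borel_measurable (lborel \<Otimes>\<^sub>M lborel)"
    by (simp add: lborel_prod)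
  show 1: "(\<integral>\<^sup>+p. f p \<partial>lborel) = (\<integral>\<^sup>+x. \<integral>\<^sup>+y. f (x, y) \<partial>lborel \<partial>lborel)"
    using lborel.nn_integral_fst[OF m] by (simp add: lborel_prod)
  show "(\<integral>\<^sup>+p. f p \<partial>lborel) = (\<integral>\<^sup>+y. \<integral>\<^sup>+x. f (x, y) \<partial>lborel \<partial>lborel)"
    unfolding 1 by (rule lborel_pair.Fubini'[symmetric]) measurable
qed

lemma nn_integral_gauss_Pair:
  fixes f :: "'a::euclidean_space \<times> 'b::euclidean_space \<Rightarrow> ennreal"
  assumes [measurable]: "f \<in> borel_measurable borel"
  shows "(\<integral>\<^sup>+p. f p \<partial>gauss) = (\<integral>\<^sup>+x. \<integral>\<^sup>+y. f (x, y) \<partial>gauss \<partial>gauss)"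
proof -
  have e: "ennreal (exp (- (norm (x, y))\<^sup>2)) = ennreal (exp (- (norm x)\<^sup>2)) * ennreal (exp (- (norm y)\<^sup>2))"
    for x :: 'a and y :: 'b
    by (simp add: norm_Pair exp_add[symmetric] flip: ennreal_mult')
  have "(\<integral>\<^sup>+p. f p \<partial>gauss) = (\<integral>\<^sup>+p. ennreal (exp (- (norm p)\<^sup>2)) * f p \<partial>lborel)"
    by (simp add: gauss_def nn_integral_density)
  also have "\<dots> = (\<integral>\<^sup>+x. \<integral>\<^sup>+y. ennreal (exp (- (norm x)\<^sup>2)) * (ennreal (exp (- (norm y)\<^sup>2)) * f (x, y)) \<partial>lborel \<partial>lborel)"
    by (subst nn_integral_lborel_Pair(1)) (simp_all add: e mult.assoc)
  also have "\<dots> = (\<integral>\<^sup>+x. ennreal (exp (- (norm x)\<^sup>2)) * (\<integral>\<^sup>+y. ennreal (exp (- (norm y)\<^sup>2)) * f (x, y) \<partial>lborel) \<partial>lborel)"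
    by (subst nn_integral_cmult) simp_all
  also have "\<dots> = (\<integral>\<^sup>+x. \<integral>\<^sup>+y. f (x, y) \<partial>gauss \<partial>gauss)"
    by (simp add: gauss_def nn_integral_density)
  finally show ?thesis .
qed

lemma gauss_prod: "gauss \<Otimes>\<^sub>M gauss = (gauss :: ('a::euclidean_space \<times> 'b::euclidean_space) measure)"
proof (rule measure_eqI)
  have s: "sets (gauss \<Otimes>\<^sub>M gauss :: ('a \<times> 'b) measure) = sets borel"
    by (simp add: borel_prod[symmetric] cong: sets_pair_measure_cong)
  then show "sets (gauss \<Otimes>\<^sub>M gauss) = sets (gauss :: ('a \<times> 'b) measure)" by simp
  fix A :: "('a \<times> 'b) set" assume A: "A \<in> sets (gauss \<Otimes>\<^sub>M gauss)"
  then have [measurable]: "A \<in> sets borel" using s by simp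
  have "emeasure gauss A = (\<integral>\<^sup>+p. indicator A p \<partial>gauss)" by simp
  also have "\<dots> = (\<integral>\<^sup>+x. \<integral>\<^sup>+y. indicator A (x, y) \<partial>gauss \<partial>gauss)"
    by (rule nn_integral_gauss_Pair) measurable
  also have "\<dots> = emeasure (gauss \<Otimes>\<^sub>M gauss) A"
    using A by (subst gauss.emeasure_pair_measure) auto
  finally show "emeasure (gauss \<Otimes>\<^sub>M gauss) A = emeasure gauss A" by simp
qed

section \<open>Unitary matrices of determinant one and the symplectic form\<close>

text \<open>
  The matrix in \<open>SU(2)\<close> with first column \<open>u\<close>, for \<open>u\<close> a unit vector.
\<close>

definition su2 :: "complex \<times> complex \<Rightarrow> complex \<times> complex \<Rightarrow> complex \<times> complex" where
  "su2 u y = (fst u * fst y - cnj (snd u) * snd y, snd u * fst y + cnj (fst u) * snd y)"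

lemma measurable_su2 [measurable]: "su2 u \<in> borel_measurable borel"
  unfolding su2_def by (intro borel_measurable_continuous_onI continuous_intros)

lemma norm_prod_complex: "(norm (u :: complex \<times> complex))\<^sup>2 = (cmod (fst u))\<^sup>2 + (cmod (snd u))\<^sup>2"
  by (cases u) (simp add: norm_Pair)

lemma unit_prod_complex:
  assumes "norm (u :: complex \<times> complex) = 1"
  shows "fst u * cnj (fst u) + snd u * cnj (snd u) = 1"
proof -
  have "complex_of_real ((cmod (fst u))\<^sup>2 + (cmod (snd u))\<^sup>2) = 1"
    using norm_prod_complex[of u] assms by simp
  then show ?thesis by (simp only: of_real_add complex_norm_square)
qed

lemma norm_su2:
  assumes "norm u = 1"
  shows "norm (su2 u y) = norm y"
proof -
  let ?a = "fst u" and ?b = "snd u"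
  have "complex_of_real ((norm (su2 u y))\<^sup>2) =
      (?a * cnj ?a + ?b * cnj ?b) * (fst y * cnj (fst y) + snd y * cnj (snd y))"
    unfolding norm_prod_complex of_real_add complex_norm_square
    by (simp add: su2_def algebra_simps)
  also have "\<dots> = complex_of_real ((norm y)\<^sup>2)"
    unfolding norm_prod_complex of_real_add complex_norm_square unit_prod_complex[OF assms] by simp
  finally have "(norm (su2 u y))\<^sup>2 = (norm y)\<^sup>2" by (simp only: of_real_eq_iff)
  then show ?thesis by simp
qed

lemma omega_su2:
  assumes "norm u = 1"
  shows "omega (su2 u y) (su2 u z) = omega y z"
proof -
  have "omega (su2 u y) (su2 u z) = (fst u * cnj (fst u) + snd u * cnj (snd u)) * omega y z"
    by (simp add: omega_def su2_def algebra_simps)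
  with unit_prod_complex[OF assms] show ?thesis by simp
qed

lemma unit_direction:
  fixes x :: "complex \<times> complex"
  obtains u where "norm u = 1" "x = norm x *\<^sub>R u"
proof (cases "x = 0")
  case True
  then show ?thesis using that[of "(1, 0)"] by (simp add: norm_Pair zero_prod_def)
next
  case False
  then show ?thesis using that[of "sgn x"] by (simp add: norm_sgn sgn_div_norm)
qed

text \<open>
  A matrix \<open>(a, b'; b, a')\<close> of determinant one with \<open>b \<noteq> 0\<close> is a product of three shears, and shears
  preserve Lebesgue measure by Tonelli's theorem and translation invariance.
\<close>

lemma nn_integral_lborel_su2_shears:
  fixes f :: "complex \<times> complex \<Rightarrow> ennreal"
  assumes [measurable]: "f \<in> borel_measurable borel" and u: "norm u = 1" and b: "snd u \<noteq> 0"
  shows "(\<integral>\<^sup>+y. f (su2 u y) \<partial>lborel) = (\<integral>\<^sup>+y. f y \<partial>lborel)"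
proof -
  let ?a = "fst u" and ?b = "snd u"
  define S where "S t y = (t * snd y + fst y, snd y)" for t and y :: "complex \<times> complex"
  define L where "L t y = (fst y, t * fst y + snd y)" for t and y :: "complex \<times> complex"
  have [measurable]: "S t \<in> borel_measurable borel" "L t \<in> borel_measurable borel" for t
    unfolding S_def L_def by (intro borel_measurable_continuous_onI continuous_intros)+
  have S: "(\<integral>\<^sup>+y. g (S t y) \<partial>lborel) = (\<integral>\<^sup>+y. g y \<partial>lborel)"
    if [measurable]: "g \<in> borel_measurable borel" for g :: "complex \<times> complex \<Rightarrow> ennreal" and t
    by (subst (1 2) nn_integral_lborel_Pair(2), measurable)
       (simp add: S_def nn_integral_lborel_translate[of "\<lambda>x. g (x, _)"])
  have L: "(\<integral>\<^sup>+y. g (L t y) \<partial>lborel) = (\<integral>\<^sup>+y. g y \<partial>lborel)"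
    if [measurable]: "g \<in> borel_measurable borel" for g :: "complex \<times> complex \<Rightarrow> ennreal" and t
    by (subst (1 2) nn_integral_lborel_Pair(1), measurable)
       (simp add: L_def nn_integral_lborel_translate[of "\<lambda>x. g (_, x)"])
  have eq: "su2 u y = S ((?a - 1) / ?b) (L ?b (S ((cnj ?a - 1) / ?b) y))" (is "_ = ?r") for y
  proof (rule prod_eqI)
    define p where "p = (cnj ?a - 1) / ?b * snd y + fst y"
    have p: "?b * p = (cnj ?a - 1) * snd y + ?b * fst y"
      using b by (simp add: p_def distrib_left)
    have bb: "?b * cnj ?b = 1 - ?a * cnj ?a"
      using unit_prod_complex[OF u] by (simp add: algebra_simps)
    have r: "fst ?r = (?a - 1) / ?b * (?b * p + snd y) + p" "snd ?r = ?b * p + snd y"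
      by (simp_all add: S_def L_def p_def)
    show "snd (su2 u y) = snd ?r"
      unfolding r p by (simp add: su2_def algebra_simps)
    have "?b * fst ?r = (?a - 1) * (?b * p + snd y) + ?b * p"
      unfolding r using b by (simp add: distrib_left)
    also have "\<dots> = ?a * ?b * fst y - (1 - ?a * cnj ?a) * snd y"
      unfolding p by (simp add: algebra_simps)
    also have "\<dots> = ?b * fst (su2 u y)"
      unfolding bb[symmetric] by (simp add: su2_def algebra_simps)
    finally show "fst (su2 u y) = fst ?r" using b by simp
  qed
  show ?thesis
    unfolding eq
    by (subst S[where g = "\<lambda>y. f (S ((?a - 1) / ?b) (L ?b y))"], measurable,
        subst L[where g = "\<lambda>y. f (S ((?a - 1) / ?b) y)"], measurable, rule S) measurable
qed

lemma nn_integral_lborel_su2: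
  fixes f :: "complex \<times> complex \<Rightarrow> ennreal"
  assumes [measurable]: "f \<in> borel_measurable borel" and u: "norm u = 1"
  shows "(\<integral>\<^sup>+y. f (su2 u y) \<partial>lborel) = (\<integral>\<^sup>+y. f y \<partial>lborel)"
proof (cases "snd u = 0")
  case True
  \<comment> \<open>a diagonal matrix is a product of two matrices with nonzero off-diagonal entries\<close>
  have eq: "su2 u y = su2 (0, 1) (su2 (0, - fst u) y)" for y
    using True by (simp add: su2_def)
  have n: "norm (0 :: complex, 1 :: complex) = 1" "norm (0 :: complex, - fst u) = 1" "fst u \<noteq> 0"
    using u True by (cases u; auto simp: norm_Pair)+
  show ?thesis
    unfolding eq using n
    by (subst nn_integral_lborel_su2_shears[where f = "\<lambda>y. f (su2 (0, 1) y)"])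
       (simp_all add: nn_integral_lborel_su2_shears)
next
  case False
  then show ?thesis using u by (intro nn_integral_lborel_su2_shears) auto
qed

lemma nn_integral_gauss_su2:
  fixes f :: "complex \<times> complex \<Rightarrow> ennreal"
  assumes [measurable]: "f \<in> borel_measurable borel" and u: "norm u = 1"
  shows "(\<integral>\<^sup>+y. f (su2 u y) \<partial>gauss) = (\<integral>\<^sup>+y. f y \<partial>gauss)"
  using nn_integral_lborel_su2[of "\<lambda>y. ennreal (exp (- (norm y)\<^sup>2)) * f y" u] u
  by (simp add: gauss_def nn_integral_density norm_su2)

lemma measurable_omega [measurable (raw)]:
  assumes [measurable]: "f \<in> borel_measurable M" "g \<in> borel_measurable M"
  shows "(\<lambda>x. omega (f x) (g x)) \<in> borel_measurable M"
  by (rule borel_measurable_continuous_Pair[OF assms]) (auto simp: omega_def intro!: continuous_intros)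

lemma omega_swap: "omega x y = - omega y x"
  by (simp add: omega_def)

lemma omega_scaleR:
  "omega (r *\<^sub>R x) y = r *\<^sub>R omega x y" "omega x (r *\<^sub>R y) = r *\<^sub>R omega x y"
  by (simp_all add: omega_def scaleR_conv_of_real algebra_simps)

text \<open>
  By rotation invariance a linear form in a Gaussian vector depends on its coefficients only through
  their norm: an element of \<open>SU(2)\<close> moves the coefficient vector to \<open>(\<bar>h\<bar>, 0)\<close>.
\<close>

lemma nn_integral_gauss_linear_form:
  fixes g :: "real \<Rightarrow> ennreal"
  assumes [measurable]: "g \<in> borel_measurable borel"
  shows "(\<integral>\<^sup>+v. g (Re (fst h * fst v - snd h * snd v)) \<partial>gauss) =
    (\<integral>\<^sup>+v. g (norm h * Re (fst v)) \<partial>(gauss :: (complex \<times> complex) measure))"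
proof -
  obtain w where w: "norm w = 1" "h = norm h *\<^sub>R w" by (rule unit_direction)
  \<comment> \<open>after the rotation with first column \<open>u\<close> the form is \<open>\<bar>h\<bar>\<close> times the first coordinate\<close>
  define u where "u = (cnj (fst w), - cnj (snd w))"
  have u: "norm u = 1" using w(1) by (simp add: u_def norm_Pair norm_prod_def)
  have "fst h * fst (su2 u v) - snd h * snd (su2 u v) = norm h *\<^sub>R fst v" for v
  proof -
    have "fst w * fst (su2 u v) - snd w * snd (su2 u v) =
        (fst w * cnj (fst w) + snd w * cnj (snd w)) * fst v"
      by (simp add: su2_def u_def algebra_simps)
    then have "fst w * fst (su2 u v) - snd w * snd (su2 u v) = fst v"
      using unit_prod_complex[OF w(1)] by simp
    then show ?thesis
      by (subst (1 2) w(2)) (simp flip: scaleR_diff_right)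
  qed
  then have "(\<integral>\<^sup>+v. g (norm h * Re (fst v)) \<partial>(gauss :: (complex \<times> complex) measure)) =
      (\<integral>\<^sup>+v. g (Re (fst h * fst (su2 u v) - snd h * snd (su2 u v))) \<partial>gauss)"
    by simp
  also have "\<dots> = (\<integral>\<^sup>+v. g (Re (fst h * fst v - snd h * snd v)) \<partial>gauss)"
    by (rule nn_integral_gauss_su2[OF _ u]) measurable
  finally show ?thesis ..
qed

text \<open>
  The slice of the law at a fixed \<open>x\<close>. A rotation reduces to \<open>x = (\<bar>x\<bar>, 0)\<close>; afterwards
  \<open>h\<close> collects the second coordinates of \<open>y\<close> and \<open>z\<close>, and \<open>v\<close> the first ones, in which the
  remaining product \<open>Re (omega y z)\<close> is linear.
\<close>

lemma nn_integral_omega_slice: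
  fixes f :: "real \<times> real \<times> real \<Rightarrow> ennreal" and x :: "complex \<times> complex"
  assumes [measurable]: "f \<in> borel_measurable borel"
  shows "(\<integral>\<^sup>+y. \<integral>\<^sup>+z. f (Re (omega y z), Re (omega z x), Re (omega x y)) \<partial>gauss \<partial>gauss) =
    (\<integral>\<^sup>+h. \<integral>\<^sup>+v. f (norm h * Re (fst v), norm x * Re (snd h), - (norm x * Re (fst h)))
       \<partial>(gauss :: (complex \<times> complex) measure) \<partial>(gauss :: (complex \<times> complex) measure))"
    (is "?L = ?R")
proof -
  obtain u where u: "norm u = 1" "x = norm x *\<^sub>R u" by (rule unit_direction)
  let ?r = "norm x"
  have u1: "u = su2 u (1, 0)" by (simp add: su2_def)
  have zx: "omega (su2 u z) x = ?r *\<^sub>R snd z" for z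
  proof -
    have "omega (su2 u z) u = snd z"
      by (subst (2) u1) (simp add: omega_su2[OF u(1)], simp add: omega_def)
    then show ?thesis by (subst u(2)) (simp only: omega_scaleR)
  qed
  have xy: "omega x (su2 u y) = - (?r *\<^sub>R snd y)" for y
    by (subst omega_swap) (simp only: zx)
  \<comment> \<open>rotate \<open>y\<close> and \<open>z\<close> instead of \<open>x\<close>\<close>
  have "?L = (\<integral>\<^sup>+y. \<integral>\<^sup>+z. f (Re (omega (su2 u y) (su2 u z)), Re (omega (su2 u z) x), Re (omega x (su2 u y))) \<partial>gauss \<partial>gauss)"
  proof -
    have "(\<integral>\<^sup>+z. f (Re (omega y z), Re (omega z x), Re (omega x y)) \<partial>gauss) =
        (\<integral>\<^sup>+z. f (Re (omega y (su2 u z)), Re (omega (su2 u z) x), Re (omega x y)) \<partial>gauss)" for y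
      by (rule nn_integral_gauss_su2[OF _ u(1), symmetric]) measurable
    then have "?L = (\<integral>\<^sup>+y. \<integral>\<^sup>+z. f (Re (omega y (su2 u z)), Re (omega (su2 u z) x), Re (omega x y)) \<partial>gauss \<partial>gauss)"
      by simp
    also have "\<dots> = (\<integral>\<^sup>+y. \<integral>\<^sup>+z. f (Re (omega (su2 u y) (su2 u z)), Re (omega (su2 u z) x), Re (omega x (su2 u y))) \<partial>gauss \<partial>gauss)"
      by (rule nn_integral_gauss_su2[OF _ u(1), symmetric]) measurable
    finally show ?thesis .
  qed
  also have "\<dots> = (\<integral>\<^sup>+y. \<integral>\<^sup>+z. f (Re (omega y z), ?r * Re (snd z), - (?r * Re (snd y))) \<partial>gauss \<partial>gauss)"
    unfolding omega_su2[OF u(1)] zx xy by simp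
  also have "\<dots> = (\<integral>\<^sup>+y1. \<integral>\<^sup>+y2. \<integral>\<^sup>+z1. \<integral>\<^sup>+z2. f (Re (y2 * z1 - y1 * z2), ?r * Re z2, - (?r * Re y2)) \<partial>gauss \<partial>gauss \<partial>gauss \<partial>gauss)"
    by (subst nn_integral_gauss_Pair, measurable, subst nn_integral_gauss_Pair, measurable) (simp add: omega_def)
  also have "\<dots> = (\<integral>\<^sup>+y2. \<integral>\<^sup>+y1. \<integral>\<^sup>+z1. \<integral>\<^sup>+z2. f (Re (y2 * z1 - y1 * z2), ?r * Re z2, - (?r * Re y2)) \<partial>gauss \<partial>gauss \<partial>gauss \<partial>gauss)"
    by (rule gauss_pair.Fubini') measurable
  also have "\<dots> = (\<integral>\<^sup>+y2. \<integral>\<^sup>+y1. \<integral>\<^sup>+z2. \<integral>\<^sup>+z1. f (Re (y2 * z1 - y1 * z2), ?r * Re z2, - (?r * Re y2)) \<partial>gauss \<partial>gauss \<partial>gauss \<partial>gauss)"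
    by (intro nn_integral_cong gauss_pair.Fubini') measurable
  also have "\<dots> = (\<integral>\<^sup>+y2. \<integral>\<^sup>+z2. \<integral>\<^sup>+y1. \<integral>\<^sup>+z1. f (Re (y2 * z1 - y1 * z2), ?r * Re z2, - (?r * Re y2)) \<partial>gauss \<partial>gauss \<partial>gauss \<partial>gauss)"
    by (intro nn_integral_cong gauss_pair.Fubini') measurable
  also have "\<dots> = (\<integral>\<^sup>+y2. \<integral>\<^sup>+z2. \<integral>\<^sup>+z1. \<integral>\<^sup>+y1. f (Re (y2 * z1 - y1 * z2), ?r * Re z2, - (?r * Re y2)) \<partial>gauss \<partial>gauss \<partial>gauss \<partial>gauss)"
    by (intro nn_integral_cong gauss_pair.Fubini') measurable
  also have "\<dots> = (\<integral>\<^sup>+h. \<integral>\<^sup>+v. f (Re (fst h * fst v - snd h * snd v), ?r * Re (snd h), - (?r * Re (fst h)))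
       \<partial>(gauss :: (complex \<times> complex) measure) \<partial>(gauss :: (complex \<times> complex) measure))"
    by (subst nn_integral_gauss_Pair, measurable, subst nn_integral_gauss_Pair, measurable) (simp add: mult.commute)
  also have "\<dots> = ?R"
    by (intro nn_integral_cong nn_integral_gauss_linear_form[where g = "\<lambda>t. f (t, _)"]) measurable
  finally show ?thesis .
qed

theorem nn_integral_omega_triple:
  fixes f :: "real \<times> real \<times> real \<Rightarrow> ennreal"
  assumes [measurable]: "f \<in> borel_measurable borel"
  shows "(\<integral>\<^sup>+x. \<integral>\<^sup>+y. \<integral>\<^sup>+z. f (Re (omega y z), Re (omega z x), Re (omega x y)) \<partial>gauss \<partial>gauss \<partial>gauss) =
    (\<integral>\<^sup>+h. \<integral>\<^sup>+x. \<integral>\<^sup>+v. f (norm h * Re (fst v), norm h * Re (snd x), - (norm h * Re (fst x)))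
       \<partial>(gauss :: (complex \<times> complex) measure) \<partial>(gauss :: (complex \<times> complex) measure) \<partial>(gauss :: (complex \<times> complex) measure))"
proof -
  let ?G = "gauss :: (complex \<times> complex) measure"
  define F where "F = (\<lambda>p. \<integral>\<^sup>+v. f (fst p * Re (fst v), Re (snd (snd p)), - Re (fst (snd p))) \<partial>?G)"
  have F [measurable]: "F \<in> borel_measurable borel"
    unfolding F_def by measurable
  have "(\<integral>\<^sup>+x. \<integral>\<^sup>+y. \<integral>\<^sup>+z. f (Re (omega y z), Re (omega z x), Re (omega x y)) \<partial>gauss \<partial>gauss \<partial>gauss) =
    (\<integral>\<^sup>+x. \<integral>\<^sup>+h. F (norm h, norm x *\<^sub>R h) \<partial>?G \<partial>?G)"
    by (simp add: nn_integral_omega_slice F_def)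
  also have "\<dots> = (\<integral>\<^sup>+h. \<integral>\<^sup>+x. F (norm h, norm x *\<^sub>R h) \<partial>?G \<partial>?G)"
    by (rule gauss_pair.Fubini') measurable
  also have "\<dots> = (\<integral>\<^sup>+h. \<integral>\<^sup>+x. F (norm h, norm h *\<^sub>R x) \<partial>?G \<partial>?G)"
    by (rule nn_integral_swap_directions) measurable
  finally show ?thesis by (simp add: F_def)
qed

section \<open>Gaussian moments\<close>

lemma nn_integral_gauss_mult:
  fixes f :: "'a::euclidean_space \<Rightarrow> ennreal" and g :: "'b::euclidean_space \<Rightarrow> ennreal"
  assumes [measurable]: "f \<in> borel_measurable borel" "g \<in> borel_measurable borel"
  shows "(\<integral>\<^sup>+p. f (fst p) * g (snd p) \<partial>gauss) = (\<integral>\<^sup>+x. f x \<partial>gauss) * (\<integral>\<^sup>+y. g y \<partial>gauss)"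
  by (subst nn_integral_gauss_Pair, measurable)
     (simp add: nn_integral_cmult nn_integral_multc)

lemma has_bochner_integral_gauss_mult:
  fixes f :: "'a::euclidean_space \<Rightarrow> complex" and g :: "'b::euclidean_space \<Rightarrow> complex"
  assumes f: "has_bochner_integral gauss f a" and g: "has_bochner_integral gauss g b"
  shows "has_bochner_integral gauss (\<lambda>p. f (fst p) * g (snd p)) (a * b)"
proof -
  have [measurable]: "f \<in> borel_measurable borel" "g \<in> borel_measurable borel"
    using f g by (auto simp: has_bochner_integral_iff dest!: borel_measurable_integrable)
  have "(\<integral>\<^sup>+p. norm (f (fst p) * g (snd p)) \<partial>gauss) =
      (\<integral>\<^sup>+x. norm (f x) \<partial>gauss) * (\<integral>\<^sup>+y. norm (g y) \<partial>gauss)"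
    by (simp add: norm_mult ennreal_mult' nn_integral_gauss_mult[of "\<lambda>x. ennreal (norm (f x))" "\<lambda>x. ennreal (norm (g x))"])
  also have "\<dots> < \<infinity>"
    using f g by (auto simp: has_bochner_integral_iff integrable_iff_bounded ennreal_mult_less_top)
  finally have int: "integrable gauss (\<lambda>p. f (fst p) * g (snd p))"
    by (simp add: integrable_iff_bounded)
  then have "integrable (gauss \<Otimes>\<^sub>M gauss) (\<lambda>p. f (fst p) * g (snd p))"
    by (simp add: gauss_prod)
  from gauss_pair.integral_fst'[OF this] have "(LINT p|gauss. f (fst p) * g (snd p)) = a * b"
    using f g by (simp add: gauss_prod has_bochner_integral_iff)
  with int show ?thesis by (simp add: has_bochner_integral_iff)
qed

text \<open>
  Absolute moments on the line are the one-dimensional case of the polar formula, with the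
  two-point sphere.
\<close>

lemma emeasure_sphere_measure_S0: "emeasure (sphere_measure :: real measure) (sphere 0 1) = 2"
proof -
  have "emeasure (sphere_measure :: real measure) (sphere 0 1)
      = (\<integral>\<^sup>+(\<theta>::real). 1 \<partial>sphere_measure)"
    by (simp add: space_sphere_measure)
  also have "\<dots> = of_nat DIM(real) * (\<integral>\<^sup>+(x::real). 1 * indicator (ball 0 1 - {0}) x \<partial>lborel)"
    by (rule nn_integral_sphere_measure) simp
  also have "\<dots> = emeasure lborel (ball 0 1 - {0} :: real set)" by simp
  also have "\<dots> = emeasure lborel (ball 0 1 :: real set)"
    by (subst emeasure_Diff) auto
  also have "\<dots> = 2" by (simp add: ball_eq_greaterThanLessThan)
  finally show ?thesis .
qed

lemma nn_integral_norm_powr: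
  fixes s :: real
  assumes "s + DIM('a::euclidean_space) > 0"
  shows "(\<integral>\<^sup>+(x::'a). ennreal (norm x powr s) \<partial>gauss) =
    ennreal (Gamma ((s + DIM('a)) / 2) / 2) * emeasure (sphere_measure :: 'a measure) (sphere 0 1)"
proof -
  have "(\<integral>\<^sup>+(x::'a). ennreal (norm x powr s) \<partial>gauss) =
      ennreal (Gamma ((s + DIM('a)) / 2) / 2) * (\<integral>\<^sup>+(x::'a). ennreal (norm x powr s) \<partial>sphere_measure)"
    using assms by (intro nn_integral_gauss_homogeneous) (auto simp: powr_mult ennreal_mult')
  also have "(\<integral>\<^sup>+(x::'a). ennreal (norm x powr s) \<partial>sphere_measure) = (\<integral>\<^sup>+(x::'a). 1 \<partial>sphere_measure)"
    by (rule nn_integral_cong) (simp add: space_sphere_measure)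
  finally show ?thesis by (simp add: space_sphere_measure)
qed

lemma has_bochner_integral_norm_powr:
  fixes s :: complex
  assumes s: "Re s + DIM('a::euclidean_space) > 0"
  shows "has_bochner_integral gauss (\<lambda>x::'a. complex_of_real (norm x) powr s)
    (Gamma ((s + of_nat DIM('a)) / 2) / 2 * of_real (measure (sphere_measure :: 'a measure) (sphere 0 1)))"
proof -
  interpret S: finite_measure "sphere_measure :: 'a measure" by (rule finite_measure_sphere_measure)
  have fin: "emeasure (sphere_measure :: 'a measure) (sphere 0 1) < \<infinity>"
    using S.emeasure_finite by (metis infinity_ennreal_def top.not_eq_extremum)
  have "(\<integral>\<^sup>+(x::'a). norm (complex_of_real (norm x) powr s) \<partial>gauss) < \<infinity>"
    using nn_integral_norm_powr[where 'a='a, of "Re s"] s fin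
    by (simp add: norm_powr_real_powr ennreal_mult_less_top)
  then have "integrable gauss (\<lambda>x::'a. complex_of_real (norm x) powr s)"
    by (simp add: integrable_iff_bounded)
  moreover have "(LINT (x::'a)|gauss. complex_of_real (norm x) powr s) =
      Gamma ((s + of_nat DIM('a)) / 2) / 2 * (LINT (x::'a)|sphere_measure. complex_of_real (norm x) powr s)"
    using s by (intro integral_gauss_homogeneous) (auto simp: powr_times_real)
  moreover have "(LINT (x::'a)|sphere_measure. complex_of_real (norm x) powr s) = (LINT (x::'a)|sphere_measure. 1)"
    by (rule Bochner_Integration.integral_cong) (simp_all add: space_sphere_measure)
  ultimately show ?thesis by (simp add: has_bochner_integral_iff space_sphere_measure scaleR_conv_of_real)
qed

lemma nn_integral_abs_powr:
  assumes "a > -1"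
  shows "(\<integral>\<^sup>+(t::real). ennreal (\<bar>t\<bar> powr a) \<partial>gauss) = ennreal (Gamma ((a + 1) / 2))"
proof -
  have "(\<integral>\<^sup>+(t::real). ennreal (\<bar>t\<bar> powr a) \<partial>gauss) = ennreal (Gamma ((a + 1) / 2) / 2) * ennreal 2"
    using nn_integral_norm_powr[where 'a=real, of a] assms by (simp add: emeasure_sphere_measure_S0)
  also have "\<dots> = ennreal (Gamma ((a + 1) / 2))"
    by (subst ennreal_mult''[symmetric]) auto
  finally show ?thesis .
qed

lemma has_bochner_integral_abs_powr:
  assumes "Re a > -1"
  shows "has_bochner_integral gauss (\<lambda>t::real. complex_of_real \<bar>t\<bar> powr a) (Gamma ((a + 1) / 2))"
proof -
  have "measure (sphere_measure :: real measure) (sphere 0 1) = 2"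
    by (simp add: measure_def emeasure_sphere_measure_S0)
  with has_bochner_integral_norm_powr[where 'a=real, of a] assms show ?thesis by simp
qed

lemma nn_integral_gauss_real_one: "(\<integral>\<^sup>+(t::real). 1 \<partial>gauss) = ennreal (sqrt pi)"
proof -
  have "(\<integral>\<^sup>+(t::real). 1 \<partial>gauss) = (\<integral>\<^sup>+(t::real). ennreal (\<bar>t\<bar> powr 0) \<partial>gauss)"
  proof (rule nn_integral_cong_AE)
    have "AE t in (gauss :: real measure). t \<noteq> 0"
      unfolding gauss_def by (subst AE_density) (auto intro!: AE_I[of _ _ "{0}"])
    then show "AE t in gauss. 1 = ennreal (\<bar>t :: real\<bar> powr 0)" by eventually_elim simp
  qed
  then show ?thesis using nn_integral_abs_powr[of 0] by (simp add: Gamma_one_half_real)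
qed

lemma lborel_complex:
  "(lborel :: complex measure) = distr (lborel :: (real \<times> real) measure) borel (\<lambda>p. Complex (fst p) (snd p))"
proof (rule lborel_eqI)
  have [measurable]: "(\<lambda>p. Complex (fst p) (snd p)) \<in> borel_measurable (borel :: (real \<times> real) measure)"
    unfolding Complex_eq by measurable
  fix l u :: complex
  assume le: "\<And>b. b \<in> Basis \<Longrightarrow> l \<bullet> b \<le> u \<bullet> b"
  have vi: "(\<lambda>p. Complex (fst p) (snd p)) -` box l u = box (Re l) (Re u) \<times> box (Im l) (Im u)"
    by (auto simp: box_def Basis_complex_def inner_complex_def)
  have "emeasure (distr (lborel :: (real \<times> real) measure) borel (\<lambda>p. Complex (fst p) (snd p))) (box l u) =
      emeasure (lborel \<Otimes>\<^sub>M lborel) (box (Re l) (Re u) \<times> box (Im l) (Im u))"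
    by (subst emeasure_distr) (simp_all add: vi lborel_prod)
  also have "\<dots> = ennreal (Re u - Re l) * ennreal (Im u - Im l)"
    using le[of 1] le[of \<i>]
    by (subst lborel.emeasure_pair_measure_Times) (auto simp: Basis_complex_def inner_complex_def box_real)
  also have "\<dots> = ennreal (\<Prod>b\<in>Basis. (u - l) \<bullet> b)"
    using le[of 1] le[of \<i>] by (simp add: Basis_complex_def inner_complex_def ennreal_mult'')
  finally show "emeasure (distr (lborel :: (real \<times> real) measure) borel (\<lambda>p. Complex (fst p) (snd p))) (box l u) =
     ennreal (\<Prod>b\<in>Basis. (u - l) \<bullet> b)" .
qed simp

lemma measurable_Complex [measurable (raw)]:
  assumes [measurable]: "f \<in> borel_measurable M" "g \<in> borel_measurable M"
  shows "(\<lambda>x. Complex (f x) (g x)) \<in> borel_measurable M"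
  unfolding Complex_eq by measurable

lemma nn_integral_gauss_complex:
  fixes f :: "complex \<Rightarrow> ennreal"
  assumes [measurable]: "f \<in> borel_measurable borel"
  shows "(\<integral>\<^sup>+c. f c \<partial>gauss) = (\<integral>\<^sup>+p. f (Complex (fst p) (snd p)) \<partial>gauss)"
proof -
  have e: "(norm (Complex (fst p) (snd p)))\<^sup>2 = (norm p)\<^sup>2" for p :: "real \<times> real"
    by (simp add: cmod_def norm_prod_def)
  have "(\<integral>\<^sup>+c. f c \<partial>gauss) = (\<integral>\<^sup>+c. ennreal (exp (- (norm c)\<^sup>2)) * f c \<partial>lborel)"
    by (simp add: gauss_def nn_integral_density)
  also have "\<dots> = (\<integral>\<^sup>+p. ennreal (exp (- (norm p)\<^sup>2)) * f (Complex (fst p) (snd p)) \<partial>lborel)"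
    by (subst lborel_complex, subst nn_integral_distr) (simp_all only: e, measurable)
  also have "\<dots> = (\<integral>\<^sup>+p. f (Complex (fst p) (snd p)) \<partial>gauss)"
    by (simp add: gauss_def nn_integral_density)
  finally show ?thesis .
qed

lemma gauss_complex:
  "(gauss :: complex measure) = distr gauss borel (\<lambda>p. Complex (fst p) (snd p))"
proof (rule measure_eqI)
  fix A :: "complex set" assume "A \<in> sets gauss"
  then have [measurable]: "A \<in> sets borel" by simp
  have "emeasure gauss A = (\<integral>\<^sup>+c. indicator A c \<partial>gauss)" by simp
  also have "\<dots> = (\<integral>\<^sup>+p. indicator A (Complex (fst p) (snd p)) \<partial>gauss)"
    by (rule nn_integral_gauss_complex) measurable
  also have "\<dots> = (\<integral>\<^sup>+c. indicator A c \<partial>distr gauss borel (\<lambda>p. Complex (fst p) (snd p)))"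
    by (subst nn_integral_distr) simp_all
  finally show "emeasure gauss A = emeasure (distr gauss borel (\<lambda>p. Complex (fst p) (snd p))) A" by simp
qed simp

lemma nn_integral_abs_Re_powr:
  assumes "a > -1"
  shows "(\<integral>\<^sup>+c. ennreal (\<bar>Re c\<bar> powr a) \<partial>gauss) = ennreal (sqrt pi * Gamma ((a + 1) / 2))"
proof -
  have "(\<integral>\<^sup>+c. ennreal (\<bar>Re c\<bar> powr a) \<partial>gauss) = (\<integral>\<^sup>+p. ennreal (\<bar>fst p\<bar> powr a) * 1 \<partial>(gauss :: (real \<times> real) measure))"
    by (subst nn_integral_gauss_complex) simp_all
  also have "\<dots> = (\<integral>\<^sup>+(t::real). ennreal (\<bar>t\<bar> powr a) \<partial>gauss) * (\<integral>\<^sup>+(t::real). 1 \<partial>gauss)"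
    by (rule nn_integral_gauss_mult) measurable
  also have "\<dots> = ennreal (sqrt pi * Gamma ((a + 1) / 2))"
    unfolding nn_integral_gauss_real_one nn_integral_abs_powr[OF assms]
    by (subst ennreal_mult''[symmetric]) (simp_all add: mult.commute)
  finally show ?thesis .
qed

lemma nn_integral_gauss_complex_one: "(\<integral>\<^sup>+(c::complex). 1 \<partial>gauss) = ennreal pi"
proof -
  have "(\<integral>\<^sup>+(c::complex). 1 \<partial>gauss) = (\<integral>\<^sup>+(p::real \<times> real). 1 * 1 \<partial>gauss)"
    by (subst nn_integral_gauss_complex) simp_all
  also have "\<dots> = (\<integral>\<^sup>+(t::real). 1 \<partial>gauss) * (\<integral>\<^sup>+(t::real). 1 \<partial>gauss)"
    by (rule nn_integral_gauss_mult) measurable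
  also have "\<dots> = ennreal pi"
    unfolding nn_integral_gauss_real_one by (subst ennreal_mult''[symmetric]) simp_all
  finally show ?thesis .
qed

lemma has_bochner_integral_gauss_const_one:
  assumes "(\<integral>\<^sup>+(x::'a::euclidean_space). 1 \<partial>gauss) = ennreal c" "c \<ge> 0"
  shows "has_bochner_integral gauss (\<lambda>x::'a. 1 :: complex) (of_real c)"
proof -
  have e: "emeasure (gauss :: 'a measure) UNIV = ennreal c" using assms(1) by simp
  then have "integrable gauss (\<lambda>x::'a. 1 :: complex)" by (simp add: integrable_iff_bounded)
  with e assms(2) show ?thesis by (simp add: has_bochner_integral_iff measure_def scaleR_conv_of_real)
qed

lemma has_bochner_integral_abs_Re_powr:
  assumes "Re a > -1"
  shows "has_bochner_integral gauss (\<lambda>c. complex_of_real \<bar>Re c\<bar> powr a) (of_real (sqrt pi) * Gamma ((a + 1) / 2))"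
proof -
  have "has_bochner_integral gauss (\<lambda>p :: real \<times> real. complex_of_real \<bar>fst p\<bar> powr a * 1)
      (Gamma ((a + 1) / 2) * of_real (sqrt pi))"
    using has_bochner_integral_gauss_mult[OF has_bochner_integral_abs_powr[OF assms]
      has_bochner_integral_gauss_const_one[OF nn_integral_gauss_real_one]] by simp
  then have "has_bochner_integral (distr gauss borel (\<lambda>p. Complex (fst p) (snd p)))
     (\<lambda>c. complex_of_real \<bar>Re c\<bar> powr a) (Gamma ((a + 1) / 2) * of_real (sqrt pi))"
    by (subst has_bochner_integral_distr) simp_all
  then show ?thesis by (simp only: gauss_complex[symmetric] mult.commute)
qed

section \<open>The law of the three symplectic products\<close>

text \<open>
  Real exponents, for integrals in \<open>[0, \<infinity>]\<close>; the complex exponents follow in \<open>complex_monomial\<close>,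
  whose norm this is.
\<close>

definition abs_monomial :: "real \<Rightarrow> real \<Rightarrow> real \<Rightarrow> real \<times> real \<times> real \<Rightarrow> real" where
  "abs_monomial a b c p = \<bar>fst p\<bar> powr a * \<bar>fst (snd p)\<bar> powr b * \<bar>snd (snd p)\<bar> powr c"

definition complex_monomial :: "complex \<Rightarrow> complex \<Rightarrow> complex \<Rightarrow> real \<times> real \<times> real \<Rightarrow> complex" where
  "complex_monomial a b c p = of_real \<bar>fst p\<bar> powr a * of_real \<bar>fst (snd p)\<bar> powr b * of_real \<bar>snd (snd p)\<bar> powr c"

lemma measurable_monomials [measurable]:
  "abs_monomial a b c \<in> borel_measurable borel" "complex_monomial a' b' c' \<in> borel_measurable borel"
  unfolding abs_monomial_def complex_monomial_def by measurable

lemma norm_complex_monomial: "norm (complex_monomial a b c p) = abs_monomial (Re a) (Re b) (Re c) p"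
  by (simp add: complex_monomial_def abs_monomial_def norm_mult norm_powr_real_powr)

type_synonym C2 = "complex \<times> complex"

definition omegas :: "C2 \<times> C2 \<times> C2 \<Rightarrow> real \<times> real \<times> real" where
  "omegas = (\<lambda>(x, y, z). (Re (omega y z), Re (omega z x), Re (omega x y)))"

text \<open>
  A Gaussian vector of \<open>\<real>\<^sup>3\<close>, made from real parts of coordinates of \<open>x\<close> and \<open>v\<close>, scaled by the norm
  of an independent Gaussian \<open>h\<close>.
\<close>

definition mixture :: "C2 \<times> C2 \<times> C2 \<Rightarrow> real \<times> real \<times> real" where
  "mixture = (\<lambda>(h, x, v). (norm h * Re (fst v), norm h * Re (snd x), - (norm h * Re (fst x))))"

lemma measurable_omegas [measurable]:
  "omegas \<in> borel_measurable borel" "mixture \<in> borel_measurable borel"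
  unfolding omegas_def mixture_def split_beta' by measurable

lemma nn_integral_omegas:
  fixes f :: "real \<times> real \<times> real \<Rightarrow> ennreal"
  assumes [measurable]: "f \<in> borel_measurable borel"
  shows "(\<integral>\<^sup>+p. f (omegas p) \<partial>gauss) = (\<integral>\<^sup>+p. f (mixture p) \<partial>gauss)"
proof -
  have "(\<integral>\<^sup>+p. f (omegas p) \<partial>gauss) = (\<integral>\<^sup>+x. \<integral>\<^sup>+y. \<integral>\<^sup>+z. f (omegas (x, y, z)) \<partial>gauss \<partial>gauss \<partial>gauss)"
    by (subst nn_integral_gauss_Pair, measurable, subst nn_integral_gauss_Pair) simp_all
  also have "\<dots> = (\<integral>\<^sup>+h. \<integral>\<^sup>+x. \<integral>\<^sup>+v. f (mixture (h, x, v)) \<partial>gauss \<partial>gauss \<partial>gauss)"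
    by (simp add: omegas_def mixture_def nn_integral_omega_triple)
  also have "\<dots> = (\<integral>\<^sup>+p. f (mixture p) \<partial>gauss)"
    by (subst nn_integral_gauss_Pair, measurable, subst nn_integral_gauss_Pair) simp_all
  finally show ?thesis .
qed

text \<open>
  Equality of laws is what allows complex exponents: the identity of nonnegative integrals
  transfers to Bochner integrals through the image measure.
\<close>

theorem distr_omegas: "distr gauss borel omegas = distr gauss borel mixture"
proof (rule measure_eqI)
  fix A assume "A \<in> sets (distr gauss borel omegas)"
  then have [measurable]: "A \<in> sets borel" by simp
  have "emeasure (distr gauss borel g) A = (\<integral>\<^sup>+p. indicator A (g p) \<partial>gauss)"
    if [measurable]: "g \<in> borel_measurable borel" for g :: "C2 \<times> C2 \<times> C2 \<Rightarrow> real \<times> real \<times> real"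
    by (subst nn_integral_indicator[symmetric], simp, subst nn_integral_distr) simp_all
  then show "emeasure (distr gauss borel omegas) A = emeasure (distr gauss borel mixture) A"
    by (simp add: nn_integral_omegas)
qed simp

lemma abs_monomial_mixture:
  "abs_monomial a b c (mixture p) = norm (fst p) powr (a + b + c) *
     ((\<bar>Re (fst (fst (snd p)))\<bar> powr c * \<bar>Re (snd (fst (snd p)))\<bar> powr b) *
      (\<bar>Re (fst (snd (snd p)))\<bar> powr a * 1))"
  by (cases "fst p = 0") (simp_all add: abs_monomial_def mixture_def split_beta abs_mult powr_mult powr_add)

lemma complex_monomial_mixture:
  "complex_monomial a b c (mixture p) = of_real (norm (fst p)) powr (a + b + c) *
     ((of_real \<bar>Re (fst (fst (snd p)))\<bar> powr c * of_real \<bar>Re (snd (fst (snd p)))\<bar> powr b) *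
      (of_real \<bar>Re (fst (snd (snd p)))\<bar> powr a * 1))"
  by (cases "fst p = 0") (simp_all add: complex_monomial_def mixture_def split_beta abs_mult powr_times_real powr_add)

lemma nn_integral_abs_monomial_omegas:
  assumes "a > -1" "b > -1" "c > -1"
  shows "(\<integral>\<^sup>+p. ennreal (abs_monomial a b c (omegas p)) \<partial>gauss) =
    ennreal (pi ^ 4 * sqrt pi * (Gamma ((a + b + c + 4) / 2) *
      (Gamma ((a + 1) / 2) * Gamma ((b + 1) / 2) * Gamma ((c + 1) / 2))))"
proof -
  have G: "(\<integral>\<^sup>+(h::C2). ennreal (norm h powr (a + b + c)) \<partial>gauss) = ennreal (pi\<^sup>2 * Gamma ((a + b + c + 4) / 2))"
    using nn_integral_norm_powr[where 'a=C2, of "a + b + c"] assms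
    by (simp add: emeasure_sphere_measure_S3 mult_ac flip: ennreal_mult'')
  have X: "(\<integral>\<^sup>+(x::C2). ennreal (\<bar>Re (fst x)\<bar> powr c) * ennreal (\<bar>Re (snd x)\<bar> powr b) \<partial>gauss) =
      ennreal (sqrt pi * Gamma ((c + 1) / 2)) * ennreal (sqrt pi * Gamma ((b + 1) / 2))"
    using nn_integral_gauss_mult[of "\<lambda>c'. ennreal (\<bar>Re c'\<bar> powr c)" "\<lambda>c. ennreal (\<bar>Re c\<bar> powr b)"] assms
    by (simp add: nn_integral_abs_Re_powr)
  have V: "(\<integral>\<^sup>+(v::C2). ennreal (\<bar>Re (fst v)\<bar> powr a) * 1 \<partial>gauss) =
      ennreal (sqrt pi * Gamma ((a + 1) / 2)) * ennreal pi"
    using nn_integral_gauss_mult[of "\<lambda>c. ennreal (\<bar>Re c\<bar> powr a)" "\<lambda>c::complex. 1"] assms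
    by (simp add: nn_integral_abs_Re_powr nn_integral_gauss_complex_one[simplified])
  have "(\<integral>\<^sup>+p. ennreal (abs_monomial a b c (omegas p)) \<partial>gauss) =
     (\<integral>\<^sup>+p. ennreal (norm (fst p) powr (a + b + c)) *
     ((\<lambda>q. (\<lambda>x. ennreal (\<bar>Re (fst x)\<bar> powr c) * ennreal (\<bar>Re (snd x)\<bar> powr b)) (fst q) *
      (\<lambda>v. ennreal (\<bar>Re (fst v)\<bar> powr a) * 1) (snd q)) (snd p)) \<partial>(gauss :: (C2 \<times> C2 \<times> C2) measure))"
    using nn_integral_omegas[of "\<lambda>p. ennreal (abs_monomial a b c p)"] by (simp add: abs_monomial_mixture ennreal_mult'')
  also have "\<dots> = ennreal (pi\<^sup>2 * Gamma ((a + b + c + 4) / 2)) *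
      (ennreal (sqrt pi * Gamma ((c + 1) / 2)) * ennreal (sqrt pi * Gamma ((b + 1) / 2)) *
      (ennreal (sqrt pi * Gamma ((a + 1) / 2)) * ennreal pi))"
    by (subst nn_integral_gauss_mult, measurable, subst nn_integral_gauss_mult, measurable) (simp only: G X V)
  also have "\<dots> = ennreal (pi\<^sup>2 * Gamma ((a + b + c + 4) / 2) *
      (sqrt pi * Gamma ((c + 1) / 2) * (sqrt pi * Gamma ((b + 1) / 2)) *
      (sqrt pi * Gamma ((a + 1) / 2) * pi)))"
    using assms by (simp add: ennreal_mult' Gamma_real_nonneg)
  also have "pi\<^sup>2 * Gamma ((a + b + c + 4) / 2) *
      (sqrt pi * Gamma ((c + 1) / 2) * (sqrt pi * Gamma ((b + 1) / 2)) *
      (sqrt pi * Gamma ((a + 1) / 2) * pi)) =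
      (sqrt pi * sqrt pi) * pi ^ 3 * sqrt pi * (Gamma ((a + b + c + 4) / 2) *
      (Gamma ((a + 1) / 2) * Gamma ((b + 1) / 2) * Gamma ((c + 1) / 2)))"
    by (simp only: power2_eq_square power3_eq_cube mult_ac)
  also have "(sqrt pi * sqrt pi) * pi ^ 3 = pi ^ 4" by (simp add: numeral_eq_Suc)
  finally show ?thesis .
qed

lemma has_bochner_integral_complex_monomial_omegas:
  assumes "Re a > -1" "Re b > -1" "Re c > -1"
  shows "has_bochner_integral gauss (\<lambda>p. complex_monomial a b c (omegas p))
    (of_real (pi ^ 4 * sqrt pi) * (Gamma ((a + b + c + 4) / 2) *
      (Gamma ((a + 1) / 2) * Gamma ((b + 1) / 2) * Gamma ((c + 1) / 2))))"
proof -
  have m: "measure (sphere_measure :: C2 measure) (sphere 0 1) = 2 * pi\<^sup>2"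
    by (simp add: measure_def emeasure_sphere_measure_S3)
  have H: "has_bochner_integral gauss (\<lambda>h::C2. complex_of_real (norm h) powr (a + b + c))
      (Gamma ((a + b + c + 4) / 2) / 2 * of_real (2 * pi\<^sup>2))"
    using has_bochner_integral_norm_powr[where 'a=C2, of "a + b + c"] assms by (simp add: m)
  note X = has_bochner_integral_gauss_mult[OF
      has_bochner_integral_abs_Re_powr[OF assms(3)] has_bochner_integral_abs_Re_powr[OF assms(2)]]
  note V = has_bochner_integral_gauss_mult[OF has_bochner_integral_abs_Re_powr[OF assms(1)]
      has_bochner_integral_gauss_const_one[OF nn_integral_gauss_complex_one pi_ge_zero]]
  note P = has_bochner_integral_gauss_mult[OF H has_bochner_integral_gauss_mult[OF X V]]
  have "has_bochner_integral gauss (\<lambda>p. complex_monomial a b c (mixture p))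
    (Gamma ((a + b + c + 4) / 2) / 2 * of_real (2 * pi\<^sup>2) *
      (of_real (sqrt pi) * Gamma ((c + 1) / 2) * (of_real (sqrt pi) * Gamma ((b + 1) / 2)) *
       (of_real (sqrt pi) * Gamma ((a + 1) / 2) * of_real pi)))"
    unfolding complex_monomial_mixture by (rule P)
  also have "Gamma ((a + b + c + 4) / 2) / 2 * of_real (2 * pi\<^sup>2) *
      (of_real (sqrt pi) * Gamma ((c + 1) / 2) * (of_real (sqrt pi) * Gamma ((b + 1) / 2)) *
       (of_real (sqrt pi) * Gamma ((a + 1) / 2) * of_real pi)) =
      of_real ((sqrt pi * sqrt pi) * pi ^ 3 * sqrt pi) * (Gamma ((a + b + c + 4) / 2) *
      (Gamma ((a + 1) / 2) * Gamma ((b + 1) / 2) * Gamma ((c + 1) / 2)))"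
    by (simp add: power2_eq_square power3_eq_cube del: real_sqrt_mult_self)
  also have "(sqrt pi * sqrt pi) * pi ^ 3 = pi ^ 4" by (simp add: numeral_eq_Suc)
  finally have "has_bochner_integral (distr gauss borel mixture) (complex_monomial a b c) (of_real (pi ^ 4 * sqrt pi) * (Gamma ((a + b + c + 4) / 2) *
      (Gamma ((a + 1) / 2) * Gamma ((b + 1) / 2) * Gamma ((c + 1) / 2))))"
    by (subst has_bochner_integral_distr) simp_all
  then have "has_bochner_integral (distr gauss borel omegas) (complex_monomial a b c) (of_real (pi ^ 4 * sqrt pi) * (Gamma ((a + b + c + 4) / 2) *
      (Gamma ((a + 1) / 2) * Gamma ((b + 1) / 2) * Gamma ((c + 1) / 2))))"
    by (simp only: distr_omegas)
  then show ?thesis by (simp add: has_bochner_integral_iff integrable_distr_eq integral_distr)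
qed

section \<open>From Gaussian integrals to integrals over spheres\<close>

lemma measurable_sphere_projections [measurable]:
  "fst \<in> borel_measurable (sphere_measure \<Otimes>\<^sub>M N)"
  "snd \<in> borel_measurable (N \<Otimes>\<^sub>M sphere_measure)"
  by (auto intro: measurable_sphere_measureD measurable_fst measurable_snd)

lemma measurable_sphere_triple:
  assumes [measurable]: "G \<in> borel_measurable (borel :: ('a::euclidean_space \<times> 'b::euclidean_space \<times> 'c::euclidean_space) measure)"
  shows "G \<in> borel_measurable (sphere_measure \<Otimes>\<^sub>M sphere_measure \<Otimes>\<^sub>M sphere_measure)"
proof -
  have [measurable]: "(\<lambda>p :: 'a \<times> 'b \<times> 'c. fst (snd p)) \<in> borel_measurable (sphere_measure \<Otimes>\<^sub>M sphere_measure \<Otimes>\<^sub>M sphere_measure)"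
    "(\<lambda>p :: 'a \<times> 'b \<times> 'c. snd (snd p)) \<in> borel_measurable (sphere_measure \<Otimes>\<^sub>M sphere_measure \<Otimes>\<^sub>M sphere_measure)"
    by (rule measurable_compose[OF measurable_snd]; measurable)+
  have "(\<lambda>p :: 'a \<times> 'b \<times> 'c. G (fst p, fst (snd p), snd (snd p)))
      \<in> borel_measurable (sphere_measure \<Otimes>\<^sub>M sphere_measure \<Otimes>\<^sub>M sphere_measure)"
    by measurable
  then show ?thesis by simp
qed

lemma nn_integral_gauss_homogeneous_C2:
  fixes h :: "C2 \<Rightarrow> ennreal"
  assumes "h \<in> borel_measurable borel"
    and "\<And>r x. r > 0 \<Longrightarrow> h (r *\<^sub>R x) = ennreal (r powr k) * h x"
    and "k > -4"
  shows "(\<integral>\<^sup>+x. h x \<partial>gauss) = ennreal (Gamma ((k + 4) / 2) / 2) * (\<integral>\<^sup>+x. h x \<partial>sphere_measure)"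
proof -
  have d: "real DIM(C2) = 4" by simp
  show ?thesis
    using nn_integral_gauss_homogeneous[OF assms(1,2), unfolded d] assms(3) by simp
qed

text \<open>
  Integrating one variable over the sphere keeps the homogeneity in the others, so the polar
  formula can be applied three times.
\<close>

lemma nn_integral_gauss_triple_homogeneous:
  fixes G :: "C2 \<times> C2 \<times> C2 \<Rightarrow> ennreal"
  assumes [measurable]: "G \<in> borel_measurable borel"
    and x: "\<And>r x y z. r > 0 \<Longrightarrow> G (r *\<^sub>R x, y, z) = ennreal (r powr a) * G (x, y, z)"
    and y: "\<And>r x y z. r > 0 \<Longrightarrow> G (x, r *\<^sub>R y, z) = ennreal (r powr b) * G (x, y, z)"
    and z: "\<And>r x y z. r > 0 \<Longrightarrow> G (x, y, r *\<^sub>R z) = ennreal (r powr c) * G (x, y, z)"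
    and abc: "a > -4" "b > -4" "c > -4"
  shows "(\<integral>\<^sup>+p. G p \<partial>gauss) =
    ennreal (Gamma ((a + 4) / 2) / 2) * (ennreal (Gamma ((b + 4) / 2) / 2) * (ennreal (Gamma ((c + 4) / 2) / 2) *
      (\<integral>\<^sup>+p. G p \<partial>(sphere_measure \<Otimes>\<^sub>M sphere_measure \<Otimes>\<^sub>M sphere_measure))))"
proof -
  let ?S = "sphere_measure :: C2 measure" and ?K = "\<lambda>a. ennreal (Gamma ((a + 4) / 2) / 2)"
  have "(\<integral>\<^sup>+p. G p \<partial>gauss) = (\<integral>\<^sup>+x. \<integral>\<^sup>+y. \<integral>\<^sup>+z. G (x, y, z) \<partial>gauss \<partial>gauss \<partial>gauss)"
    by (subst nn_integral_gauss_Pair, measurable, subst nn_integral_gauss_Pair) simp_all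
  also have "\<dots> = (\<integral>\<^sup>+x. \<integral>\<^sup>+y. ?K c * (\<integral>\<^sup>+z. G (x, y, z) \<partial>?S) \<partial>gauss \<partial>gauss)"
  proof (intro nn_integral_cong)
    fix x y
    show "(\<integral>\<^sup>+z. G (x, y, z) \<partial>gauss) = ?K c * (\<integral>\<^sup>+z. G (x, y, z) \<partial>?S)"
    proof (rule nn_integral_gauss_homogeneous_C2[OF _ _ abc(3)])
      show "(\<lambda>z. G (x, y, z)) \<in> borel_measurable borel" by measurable
    qed (rule z)
  qed
  also have "\<dots> = (\<integral>\<^sup>+x. ?K b * (\<integral>\<^sup>+y. ?K c * (\<integral>\<^sup>+z. G (x, y, z) \<partial>?S) \<partial>?S) \<partial>gauss)"
  proof (rule nn_integral_cong)
    fix x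
    show "(\<integral>\<^sup>+y. ?K c * (\<integral>\<^sup>+z. G (x, y, z) \<partial>?S) \<partial>gauss) =
      ?K b * (\<integral>\<^sup>+y. ?K c * (\<integral>\<^sup>+z. G (x, y, z) \<partial>?S) \<partial>?S)"
    proof (rule nn_integral_gauss_homogeneous_C2[OF _ _ abc(2)])
      fix r :: real and y :: C2 assume "r > 0"
      then show "?K c * (\<integral>\<^sup>+z. G (x, r *\<^sub>R y, z) \<partial>?S) = ennreal (r powr b) * (?K c * (\<integral>\<^sup>+z. G (x, y, z) \<partial>?S))"
        by (subst y, simp, subst nn_integral_cmult, measurable) (simp only: mult_ac)
    qed measurable
  qed
  also have "\<dots> = ?K a * (\<integral>\<^sup>+x. ?K b * (\<integral>\<^sup>+y. ?K c * (\<integral>\<^sup>+z. G (x, y, z) \<partial>?S) \<partial>?S) \<partial>?S)"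
  proof (rule nn_integral_gauss_homogeneous_C2[OF _ _ abc(1)])
    fix r :: real and x :: C2 assume "r > 0"
    then show "?K b * (\<integral>\<^sup>+y. ?K c * (\<integral>\<^sup>+z. G (r *\<^sub>R x, y, z) \<partial>?S) \<partial>?S) =
        ennreal (r powr a) * (?K b * (\<integral>\<^sup>+y. ?K c * (\<integral>\<^sup>+z. G (x, y, z) \<partial>?S) \<partial>?S))"
      by (simp only: x) (simp add: nn_integral_cmult mult_ac)
  qed measurable
  also have "\<dots> = ennreal (Gamma ((a + 4) / 2) / 2) * (ennreal (Gamma ((b + 4) / 2) / 2) * (ennreal (Gamma ((c + 4) / 2) / 2) *
      (\<integral>\<^sup>+x. \<integral>\<^sup>+y. \<integral>\<^sup>+z. G (x, y, z) \<partial>?S \<partial>?S \<partial>?S)))"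
    by (simp add: nn_integral_cmult)
  also have "(\<integral>\<^sup>+x. \<integral>\<^sup>+y. \<integral>\<^sup>+z. G (x, y, z) \<partial>?S \<partial>?S \<partial>?S) = (\<integral>\<^sup>+p. G p \<partial>(?S \<Otimes>\<^sub>M ?S \<Otimes>\<^sub>M ?S))"
  proof -
    interpret SS: pair_sigma_finite ?S ?S ..
    have "sigma_finite_measure (?S \<Otimes>\<^sub>M ?S)" ..
    note SSS = sigma_finite_measure.nn_integral_fst[OF this]
    have "(\<integral>\<^sup>+y. \<integral>\<^sup>+z. G (x, y, z) \<partial>?S \<partial>?S) = (\<integral>\<^sup>+q. G (x, q) \<partial>(?S \<Otimes>\<^sub>M ?S))" for x
    proof -
      have "(\<lambda>q. G (x, fst q, snd q)) \<in> borel_measurable (?S \<Otimes>\<^sub>M ?S)" by measurable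
      then show ?thesis using sphere_meas.nn_integral_fst[of "\<lambda>q. G (x, q)" ?S] by simp
    qed
    then show ?thesis by (simp add: SSS measurable_sphere_triple)
  qed
  finally show ?thesis .
qed

lemma (in sigma_finite_measure) integral_triple:
  fixes G :: "'a \<times> 'a \<times> 'a \<Rightarrow> complex"
  assumes int: "integrable (M \<Otimes>\<^sub>M M \<Otimes>\<^sub>M M) G"
  shows "(LINT p|(M \<Otimes>\<^sub>M M \<Otimes>\<^sub>M M). G p) = (LINT x|M. LINT y|M. LINT z|M. G (x, y, z))"
proof -
  interpret MM: pair_sigma_finite M M ..
  interpret M2: sigma_finite_measure "M \<Otimes>\<^sub>M M" ..
  interpret P: pair_sigma_finite M "M \<Otimes>\<^sub>M M" ..
  have [measurable]: "G \<in> borel_measurable (M \<Otimes>\<^sub>M M \<Otimes>\<^sub>M M)" using int by auto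
  have "(LINT p|(M \<Otimes>\<^sub>M M \<Otimes>\<^sub>M M). G p) = (LINT x|M. LINT q|(M \<Otimes>\<^sub>M M). G (x, q))"
    using P.integral_fst'[OF int] by simp
  also have "\<dots> = (LINT x|M. LINT y|M. LINT z|M. G (x, y, z))"
  proof (rule integral_cong_AE)
    show "AE x in M. (LINT q|(M \<Otimes>\<^sub>M M). G (x, q)) = (LINT y|M. LINT z|M. G (x, y, z))"
      using P.AE_integrable_fst'[OF int] by eventually_elim (rule MM.integral_fst'[symmetric])
  qed measurable
  finally show ?thesis .
qed

lemma integral_gauss_homogeneous_C2:
  fixes h :: "C2 \<Rightarrow> complex"
  assumes "h \<in> borel_measurable borel"
    and "\<And>r x. r > 0 \<Longrightarrow> h (r *\<^sub>R x) = of_real r powr k * h x"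
    and "Re k > -4"
  shows "(LINT x|gauss. h x) = Gamma ((k + 4) / 2) / 2 * (LINT x|sphere_measure. h x)"
proof -
  have d: "of_nat DIM(C2) = (4 :: complex)" "real DIM(C2) = 4" by simp_all
  show ?thesis
    using integral_gauss_homogeneous[OF assms(1,2), unfolded d] assms(3) by linarith
qed

lemma integral_gauss_triple_homogeneous:
  fixes G :: "C2 \<times> C2 \<times> C2 \<Rightarrow> complex"
  assumes [measurable]: "G \<in> borel_measurable borel"
    and x: "\<And>r x y z. r > 0 \<Longrightarrow> G (r *\<^sub>R x, y, z) = of_real r powr a * G (x, y, z)"
    and y: "\<And>r x y z. r > 0 \<Longrightarrow> G (x, r *\<^sub>R y, z) = of_real r powr b * G (x, y, z)"
    and z: "\<And>r x y z. r > 0 \<Longrightarrow> G (x, y, r *\<^sub>R z) = of_real r powr c * G (x, y, z)"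
    and abc: "Re a > -4" "Re b > -4" "Re c > -4"
    and int: "integrable gauss G" "integrable (sphere_measure \<Otimes>\<^sub>M sphere_measure \<Otimes>\<^sub>M sphere_measure) G"
  shows "(LINT p|gauss. G p) =
    Gamma ((a + 4) / 2) / 2 * (Gamma ((b + 4) / 2) / 2 * (Gamma ((c + 4) / 2) / 2 *
      (LINT p|(sphere_measure \<Otimes>\<^sub>M sphere_measure \<Otimes>\<^sub>M sphere_measure). G p)))"
proof -
  let ?S = "sphere_measure :: C2 measure"
  have "(LINT p|gauss. G p) = (LINT x|gauss. LINT y|gauss. LINT z|gauss. G (x, y, z))"
    by (rule gauss.integral_triple[of G, unfolded gauss_prod]) (rule int(1))
  also have "\<dots> = (LINT x|gauss. LINT y|gauss. Gamma ((c + 4) / 2) / 2 * (LINT z|?S. G (x, y, z)))"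
  proof (intro Bochner_Integration.integral_cong refl)
    fix x y
    show "(LINT z|gauss. G (x, y, z)) = Gamma ((c + 4) / 2) / 2 * (LINT z|?S. G (x, y, z))"
    proof (rule integral_gauss_homogeneous_C2[OF _ _ abc(3)])
      show "(\<lambda>z. G (x, y, z)) \<in> borel_measurable borel" by measurable
    qed (rule z)
  qed
  also have "\<dots> = (LINT x|gauss. Gamma ((b + 4) / 2) / 2 * (LINT y|?S. Gamma ((c + 4) / 2) / 2 * (LINT z|?S. G (x, y, z))))"
  proof (rule Bochner_Integration.integral_cong)
    fix x
    show "(LINT y|gauss. Gamma ((c + 4) / 2) / 2 * (LINT z|?S. G (x, y, z))) =
      Gamma ((b + 4) / 2) / 2 * (LINT y|?S. Gamma ((c + 4) / 2) / 2 * (LINT z|?S. G (x, y, z)))"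
    proof (rule integral_gauss_homogeneous_C2[OF _ _ abc(2)])
      fix r :: real and y :: C2 assume "r > 0"
      then show "Gamma ((c + 4) / 2) / 2 * (LINT z|?S. G (x, r *\<^sub>R y, z)) =
          of_real r powr b * (Gamma ((c + 4) / 2) / 2 * (LINT z|?S. G (x, y, z)))"
        by (simp only: y integral_mult_right_zero) (simp only: mult_ac)
    qed measurable
  qed simp
  also have "\<dots> = Gamma ((a + 4) / 2) / 2 * (LINT x|?S. Gamma ((b + 4) / 2) / 2 * (LINT y|?S. Gamma ((c + 4) / 2) / 2 * (LINT z|?S. G (x, y, z))))"
  proof (rule integral_gauss_homogeneous_C2[OF _ _ abc(1)])
    fix r :: real and x :: C2 assume "r > 0"
    then show "Gamma ((b + 4) / 2) / 2 * (LINT y|?S. Gamma ((c + 4) / 2) / 2 * (LINT z|?S. G (r *\<^sub>R x, y, z))) =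
        of_real r powr a * (Gamma ((b + 4) / 2) / 2 * (LINT y|?S. Gamma ((c + 4) / 2) / 2 * (LINT z|?S. G (x, y, z))))"
      by (simp only: x integral_mult_right_zero) (simp only: mult_ac)
  qed measurable
  also have "\<dots> = Gamma ((a + 4) / 2) / 2 * (Gamma ((b + 4) / 2) / 2 * (Gamma ((c + 4) / 2) / 2 *
      (LINT x|?S. LINT y|?S. LINT z|?S. G (x, y, z))))"
    by (simp only: integral_mult_right_zero)
  also have "(LINT x|?S. LINT y|?S. LINT z|?S. G (x, y, z)) = (LINT p|(?S \<Otimes>\<^sub>M ?S \<Otimes>\<^sub>M ?S). G p)"
    by (rule sphere_meas.integral_triple[symmetric]) (rule int(2))
  finally show ?thesis .
qed

lemma abs_monomial_omegas_homogeneous: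
  assumes "r > 0"
  shows "abs_monomial a b c (omegas (r *\<^sub>R x, y, z)) = r powr (b + c) * abs_monomial a b c (omegas (x, y, z))"
    and "abs_monomial a b c (omegas (x, r *\<^sub>R y, z)) = r powr (a + c) * abs_monomial a b c (omegas (x, y, z))"
    and "abs_monomial a b c (omegas (x, y, r *\<^sub>R z)) = r powr (a + b) * abs_monomial a b c (omegas (x, y, z))"
  using assms by (simp_all add: abs_monomial_def omegas_def omega_scaleR abs_mult powr_mult powr_add)

lemma complex_monomial_omegas_homogeneous:
  assumes "r > 0"
  shows "complex_monomial a b c (omegas (r *\<^sub>R x, y, z)) = of_real r powr (b + c) * complex_monomial a b c (omegas (x, y, z))"
    and "complex_monomial a b c (omegas (x, r *\<^sub>R y, z)) = of_real r powr (a + c) * complex_monomial a b c (omegas (x, y, z))"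
    and "complex_monomial a b c (omegas (x, y, r *\<^sub>R z)) = of_real r powr (a + b) * complex_monomial a b c (omegas (x, y, z))"
  using assms by (simp_all add: complex_monomial_def omegas_def omega_scaleR abs_mult powr_times_real powr_add)

abbreviation sphere3 :: "(C2 \<times> C2 \<times> C2) measure" where
  "sphere3 \<equiv> sphere_measure \<Otimes>\<^sub>M sphere_measure \<Otimes>\<^sub>M sphere_measure"

text \<open>
  The closed form in terms of the real exponents \<open>a = - \<mu>\<^sub>1 - 2\<close>, \<open>b = - \<mu>\<^sub>2 - 2\<close>, \<open>c = - \<mu>\<^sub>3 - 2\<close>.
\<close>

definition tau_real :: "real \<Rightarrow> real \<Rightarrow> real \<Rightarrow> real" where
  "tau_real a b c = 8 * pi ^ 4 * sqrt pi * (Gamma ((a + b + c + 4) / 2) *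
      (Gamma ((a + 1) / 2) * Gamma ((b + 1) / 2) * Gamma ((c + 1) / 2))) /
     (Gamma ((b + c + 4) / 2) * Gamma ((a + c + 4) / 2) * Gamma ((a + b + 4) / 2))"

lemma nn_integral_abs_monomial_sphere3:
  assumes "a > -1" "b > -1" "c > -1"
  shows "(\<integral>\<^sup>+p. ennreal (abs_monomial a b c (omegas p)) \<partial>sphere3) = ennreal (tau_real a b c)"
proof -
  let ?J = "\<integral>\<^sup>+p. ennreal (abs_monomial a b c (omegas p)) \<partial>sphere3"
  let ?A = "pi ^ 4 * sqrt pi * (Gamma ((a + b + c + 4) / 2) *
      (Gamma ((a + 1) / 2) * Gamma ((b + 1) / 2) * Gamma ((c + 1) / 2)))"
  define K where "K = Gamma ((b + c + 4) / 2) / 2 * (Gamma ((a + c + 4) / 2) / 2 * (Gamma ((a + b + 4) / 2) / 2))"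
  have g: "Gamma ((b + c + 4) / 2) > 0" "Gamma ((a + c + 4) / 2) > 0" "Gamma ((a + b + 4) / 2) > 0"
    using assms by (auto intro!: Gamma_real_pos)
  then have K: "K > 0" by (auto simp: K_def)
  have "ennreal ?A = ennreal (Gamma ((b + c + 4) / 2) / 2) * (ennreal (Gamma ((a + c + 4) / 2) / 2) *
      (ennreal (Gamma ((a + b + 4) / 2) / 2) * ?J))"
    unfolding nn_integral_abs_monomial_omegas[OF assms, symmetric] using assms
    by (intro nn_integral_gauss_triple_homogeneous)
       (simp_all add: abs_monomial_omegas_homogeneous ennreal_mult')
  also have "\<dots> = ennreal K * ?J"
  proof -
    have m: "ennreal x * (ennreal y * (ennreal z * j)) = ennreal (x * (y * z)) * j"
      if "x > 0" "y > 0" "z > 0" for x y z j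
      using that by (simp add: ennreal_mult' mult.assoc)
    show ?thesis unfolding K_def by (rule m) (use g in auto)
  qed
  finally have e: "ennreal ?A = ennreal K * ?J" .
  have "?J = ennreal (1 / K) * (ennreal K * ?J)"
    using K by (simp add: mult.assoc[symmetric] flip: ennreal_mult')
  also have "\<dots> = ennreal (?A / K)"
    unfolding e[symmetric] using K by (subst ennreal_mult'[symmetric]) auto
  also have "?A / K = tau_real a b c"
    by (simp add: tau_real_def K_def mult_ac)
  finally show ?thesis .
qed

section \<open>The domain of absolute convergence\<close>

lemma abs_Re_omega_le: "\<bar>Re (omega x y)\<bar> \<le> norm x * norm y"
proof -
  \<comment> \<open>\<open>Re (omega x y)\<close> is the real inner product of \<open>x\<close> with a rotated copy of \<open>y\<close>\<close>
  define j where "j = (- cnj (snd y), cnj (fst y))"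
  have "Re (omega x y) = inner x j"
    by (cases x; cases y) (simp add: omega_def j_def inner_complex_def algebra_simps)
  moreover have "norm j = norm y"
    by (cases y) (simp add: j_def norm_Pair add.commute)
  ultimately show ?thesis
    using Cauchy_Schwarz_ineq2[of x j] by simp
qed

text \<open>
  On unit vectors \<open>\<bar>Re (omega x y)\<bar> \<le> 1\<close>, so larger exponents make each factor smaller.
\<close>

lemma nn_integral_abs_monomial_antimono:
  assumes "a \<le> a'" "b \<le> b'" "c \<le> c'"
  shows "(\<integral>\<^sup>+p. ennreal (abs_monomial a' b' c' (omegas p)) \<partial>sphere3) \<le> (\<integral>\<^sup>+p. ennreal (abs_monomial a b c (omegas p)) \<partial>sphere3)"
proof (intro nn_integral_mono ennreal_leI)
  fix p :: "C2 \<times> C2 \<times> C2" assume "p \<in> space sphere3"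
  then obtain x y z where p: "p = (x, y, z)" and n: "norm x = 1" "norm y = 1" "norm z = 1"
    by (cases p) (auto simp: space_pair_measure space_sphere_measure)
  have mono: "t powr s' \<le> t powr s" if "0 \<le> t" "t \<le> 1" "s \<le> s'" for t s s' :: real
    using that by (cases "t = 0") (auto intro: powr_mono')
  have le: "\<bar>Re (omega y z)\<bar> \<le> 1" "\<bar>Re (omega z x)\<bar> \<le> 1" "\<bar>Re (omega x y)\<bar> \<le> 1"
    using abs_Re_omega_le[of y z] abs_Re_omega_le[of z x] abs_Re_omega_le[of x y] n by auto
  show "abs_monomial a' b' c' (omegas p) \<le> abs_monomial a b c (omegas p)"
    unfolding abs_monomial_def p omegas_def using le assms
    by (auto intro!: mult_mono mono)
qed

text \<open>
  Were the integral finite, it would bound the closed form at the exponents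
  \<open>max a (e - 1)\<close>, \<open>max b (e - 1)\<close>, \<open>max c (e - 1)\<close> for every \<open>e > 0\<close>. But the reciprocal of
  the closed form tends to \<open>0\<close> as \<open>e\<close> does, since the reciprocal Gamma function vanishes at \<open>0\<close>.
\<close>

lemma nn_integral_abs_monomial_infinite:
  assumes "a \<le> -1 \<or> b \<le> -1 \<or> c \<le> -1"
  shows "(\<integral>\<^sup>+p. ennreal (abs_monomial a b c (omegas p)) \<partial>sphere3) = \<infinity>" (is "?J = _")
proof (rule ccontr)
  assume fin: "?J \<noteq> \<infinity>"
  define M where "M = enn2real ?J"
  have J: "?J = ennreal M" and M: "M \<ge> 0" using fin by (auto simp: M_def less_top)
  define m where "m s e = max s (-1 + e)" for s e :: real
  \<comment> \<open>up to the constant, the reciprocal of the closed form at the truncated exponents\<close>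
  define R where "R e = rGamma ((m a e + m b e + m c e + 4) / 2) *
      (rGamma ((m a e + 1) / 2) * rGamma ((m b e + 1) / 2) * rGamma ((m c e + 1) / 2)) *
     (Gamma ((m b e + m c e + 4) / 2) * Gamma ((m a e + m c e + 4) / 2) * Gamma ((m a e + m b e + 4) / 2))" for e
  have bound: "8 * pi ^ 4 * sqrt pi \<le> M * R e" if e: "e > 0" for e
  proof -
    have m: "m s e > -1" for s using e by (simp add: m_def)
    have "ennreal (tau_real (m a e) (m b e) (m c e)) \<le> ennreal M"
      unfolding J[symmetric] nn_integral_abs_monomial_sphere3[OF m m m, symmetric]
      by (rule nn_integral_abs_monomial_antimono) (simp_all add: m_def)
    then have le: "tau_real (m a e) (m b e) (m c e) \<le> M" using M by simp
    have pos: "Gamma ((m a e + m b e + m c e + 4) / 2) > 0" "Gamma ((m a e + 1) / 2) > 0"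
      "Gamma ((m b e + 1) / 2) > 0" "Gamma ((m c e + 1) / 2) > 0"
      "Gamma ((m b e + m c e + 4) / 2) > 0" "Gamma ((m a e + m c e + 4) / 2) > 0" "Gamma ((m a e + m b e + 4) / 2) > 0"
      using m[of a] m[of b] m[of c] by (auto intro!: Gamma_real_pos)
    then have Rpos: "R e > 0" by (simp add: R_def rGamma_inverse_Gamma)
    have "tau_real (m a e) (m b e) (m c e) * R e = 8 * pi ^ 4 * sqrt pi"
      unfolding tau_real_def R_def rGamma_inverse_Gamma using pos by (simp add: field_simps)
    with mult_right_mono[OF le, of "R e"] Rpos show ?thesis by simp
  qed
  have mt: "(m s \<longlongrightarrow> max s (-1)) (at_right 0)" for s
  proof -
    have "((\<lambda>e. max s (-1 + e)) \<longlongrightarrow> max s (-1 + 0)) (at_right 0)" by (intro tendsto_intros)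
    then show ?thesis by (simp add: m_def[abs_def])
  qed
  let ?a = "max a (-1)" and ?b = "max b (-1)" and ?c = "max c (-1)"
  have np: "(s + t + 4) / 2 \<notin> \<int>\<^sub>\<le>\<^sub>0" if "s \<ge> -1" "t \<ge> -1" for s t :: real
    using that by (auto elim!: nonpos_Ints_cases)
  have "(R \<longlongrightarrow> rGamma ((?a + ?b + ?c + 4) / 2) *
      (rGamma ((?a + 1) / 2) * rGamma ((?b + 1) / 2) * rGamma ((?c + 1) / 2)) *
     (Gamma ((?b + ?c + 4) / 2) * Gamma ((?a + ?c + 4) / 2) * Gamma ((?a + ?b + 4) / 2))) (at_right 0)"
    unfolding R_def[abs_def]
    by (intro tendsto_intros isCont_tendsto_compose[OF isCont_rGamma[OF continuous_ident]] mt np) auto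
  also have "(rGamma ((?a + 1) / 2) * rGamma ((?b + 1) / 2) * rGamma ((?c + 1) / 2)) = 0"
    using assms by (auto simp: max_def)
  finally have "((\<lambda>e. M * R e) \<longlongrightarrow> M * 0) (at_right 0)"
    by (intro tendsto_intros) simp
  then have "8 * pi ^ 4 * sqrt pi \<le> M * 0"
    by (rule tendsto_lowerbound) (auto intro!: eventually_at_right_less[THEN eventually_mono] bound)
  then show False using pi_gt_zero by (simp add: mult_le_0_iff not_le[symmetric])
qed

lemma tau1_integrand_eq:
  "tau1_integrand \<mu> = (\<lambda>p. complex_monomial (- \<mu>$1 - 2) (- \<mu>$2 - 2) (- \<mu>$3 - 2) (omegas p))"
  by (auto simp: tau1_integrand_def complex_monomial_def omegas_def fun_eq_iff)

lemma tau1_domain_iff: "\<mu> \<in> tau1_domain \<longleftrightarrow> (\<forall>j. Re (\<mu>$j) < -1)"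
proof -
  have [measurable]: "(\<lambda>p. complex_monomial a b c (omegas p)) \<in> borel_measurable sphere3" for a b c
    by (rule measurable_sphere_triple) measurable
  let ?J = "\<integral>\<^sup>+p. ennreal (abs_monomial (- Re (\<mu>$1) - 2) (- Re (\<mu>$2) - 2) (- Re (\<mu>$3) - 2) (omegas p)) \<partial>sphere3"
  have "\<mu> \<in> tau1_domain \<longleftrightarrow> ?J < \<infinity>"
    by (simp add: tau1_domain_def tau1_integrand_eq integrable_iff_bounded norm_complex_monomial)
  also have "\<dots> \<longleftrightarrow> (Re (\<mu>$1) < -1 \<and> Re (\<mu>$2) < -1 \<and> Re (\<mu>$3) < -1)"
  proof (cases "Re (\<mu>$1) < -1 \<and> Re (\<mu>$2) < -1 \<and> Re (\<mu>$3) < -1")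
    case True
    then show ?thesis by (subst nn_integral_abs_monomial_sphere3) auto
  next
    case False
    then show ?thesis by (subst nn_integral_abs_monomial_infinite) auto
  qed
  finally show ?thesis by (simp add: forall_3)
qed

section \<open>The integral on its domain\<close>

lemma prod_UNIV_3: "(\<Prod>j\<in>(UNIV :: 3 set). f j) = f 1 * f 2 * f 3"
  unfolding UNIV_3 by (simp add: mult.assoc)

definition tau :: "complex^3 \<Rightarrow> complex" where
  "tau \<mu> = of_real ((2 * pi powr (3/2)) ^ 3)
            * Gamma ((- \<mu>$1 - \<mu>$2 - \<mu>$3 - 2) / 2)
            * (\<Prod>j\<in>UNIV. Gamma (- 1/2 - \<mu>$j / 2)
                 / Gamma ((\<mu>$j - \<mu>$1 - \<mu>$2 - \<mu>$3) / 2))"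

theorem tau1_integral_eq:
  assumes "\<mu> \<in> tau1_domain"
  shows "tau1_integral \<mu> = tau \<mu>"
proof -
  have re: "Re (\<mu>$1) < -1" "Re (\<mu>$2) < -1" "Re (\<mu>$3) < -1"
    using assms by (auto simp: tau1_domain_iff)
  let ?a = "- \<mu>$1 - 2" and ?b = "- \<mu>$2 - 2" and ?c = "- \<mu>$3 - 2"
  have H: "has_bochner_integral gauss (\<lambda>p. complex_monomial ?a ?b ?c (omegas p))
    (of_real (pi ^ 4 * sqrt pi) * (Gamma ((?a + ?b + ?c + 4) / 2) *
      (Gamma ((?a + 1) / 2) * Gamma ((?b + 1) / 2) * Gamma ((?c + 1) / 2))))"
    using re by (intro has_bochner_integral_complex_monomial_omegas) auto
  have int: "integrable sphere3 (\<lambda>p. complex_monomial ?a ?b ?c (omegas p))"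
    using assms by (simp add: tau1_domain_def tau1_integrand_eq)
  have "(LINT p|gauss. complex_monomial ?a ?b ?c (omegas p)) =
      Gamma ((?b + ?c + 4) / 2) / 2 * (Gamma ((?a + ?c + 4) / 2) / 2 * (Gamma ((?a + ?b + 4) / 2) / 2 *
       tau1_integral \<mu>))"
    unfolding tau1_integral_def tau1_integrand_eq using re H int
    by (intro integral_gauss_triple_homogeneous)
       (auto simp: complex_monomial_omegas_homogeneous has_bochner_integral_iff)
  then have eq: "of_real (pi ^ 4 * sqrt pi) * (Gamma ((?a + ?b + ?c + 4) / 2) *
      (Gamma ((?a + 1) / 2) * Gamma ((?b + 1) / 2) * Gamma ((?c + 1) / 2))) =
      Gamma ((?b + ?c + 4) / 2) / 2 * (Gamma ((?a + ?c + 4) / 2) / 2 * (Gamma ((?a + ?b + 4) / 2) / 2 *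
       tau1_integral \<mu>))"
    using H by (simp add: has_bochner_integral_iff)
  have arg: "?a + ?b + ?c + 4 = - \<mu>$1 - \<mu>$2 - \<mu>$3 - 2"
    "?b + ?c + 4 = \<mu>$1 - \<mu>$1 - \<mu>$2 - \<mu>$3" "?a + ?c + 4 = \<mu>$2 - \<mu>$1 - \<mu>$2 - \<mu>$3"
    "?a + ?b + 4 = \<mu>$3 - \<mu>$1 - \<mu>$2 - \<mu>$3"
    "(- \<mu>$j - 2 + 1) / 2 = - 1/2 - \<mu>$j / 2" for j
    by (simp_all add: field_simps)
  have nz: "Gamma ((\<mu>$j - \<mu>$1 - \<mu>$2 - \<mu>$3) / 2) \<noteq> 0" if "j = 1 \<or> j = 2 \<or> j = 3" for j
  proof -
    have "Re ((\<mu>$j - \<mu>$1 - \<mu>$2 - \<mu>$3) / 2) > 0" using re that by auto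
    moreover have "w \<notin> \<int>\<^sub>\<le>\<^sub>0" if "Re w > 0" for w
      using that by (auto elim!: nonpos_Ints_cases)
    ultimately have "(\<mu>$j - \<mu>$1 - \<mu>$2 - \<mu>$3) / 2 \<notin> \<int>\<^sub>\<le>\<^sub>0" by blast
    then show ?thesis by (simp add: Gamma_eq_zero_iff)
  qed
  have const: "(2 * pi powr (3/2)) ^ 3 = 8 * (pi ^ 4 * sqrt pi)"
  proof -
    have "pi powr (3/2) = pi powr (1 + 1/2)" by simp
    also have "\<dots> = pi * sqrt pi" by (subst powr_add) (simp add: powr_half_sqrt)
    finally have "(2 * pi powr (3/2)) ^ 3 = 8 * (pi ^ 3 * (sqrt pi * sqrt pi) * sqrt pi)"
      by (simp add: power_mult_distrib power3_eq_cube del: real_sqrt_mult_self)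
    then show ?thesis by (simp add: numeral_eq_Suc)
  qed
  have solve: "t = of_real (8 * k) * A * (B1 / g1 * (B2 / g2) * (B3 / g3))"
    if "of_real k * (A * (B1 * B2 * B3)) = g1 / 2 * (g2 / 2 * (g3 / 2 * t))" "g1 \<noteq> 0" "g2 \<noteq> 0" "g3 \<noteq> 0"
    for t A B1 B2 B3 g1 g2 g3 :: complex and k
  proof -
    have "t * (g1 * g2 * g3) = 8 * (g1 / 2 * (g2 / 2 * (g3 / 2 * t)))" by simp
    also have "\<dots> = of_real (8 * k) * A * (B1 * B2 * B3)"
      unfolding that(1)[symmetric] by simp
    finally show ?thesis using that(2-) by (simp add: eq_divide_eq)
  qed
  show ?thesis
    unfolding tau_def const prod_UNIV_3
    by (rule solve[OF eq[unfolded arg]]; rule nz; simp)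
qed

section \<open>Holomorphic and meromorphic functions of several variables\<close>

lemma mholomorphic_on_subset: "mholomorphic_on f U \<Longrightarrow> V \<subseteq> U \<Longrightarrow> mholomorphic_on f V"
  unfolding mholomorphic_on_def by blast

lemma mholomorphic_on_const: "mholomorphic_on (\<lambda>_. c) U"
  unfolding mholomorphic_on_def by (intro ballI exI[of _ "\<lambda>_. 0"]) simp

lemma mholomorphic_on_nth: "mholomorphic_on (\<lambda>z. z $ i) U"
  unfolding mholomorphic_on_def
  by (intro ballI exI[of _ "\<lambda>z. z $ i"]) (auto intro: bounded_linear_imp_has_derivative)

lemma mholomorphic_on_diff:
  assumes "mholomorphic_on f U" "mholomorphic_on g U"
  shows "mholomorphic_on (\<lambda>z. f z - g z) U"
  unfolding mholomorphic_on_def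
proof
  fix z assume "z \<in> U"
  then obtain f' g' where f: "(f has_derivative f') (at z)" "\<forall>c v. f' (c *s v) = c * f' v"
    and g: "(g has_derivative g') (at z)" "\<forall>c v. g' (c *s v) = c * g' v"
    using assms unfolding mholomorphic_on_def by meson
  show "\<exists>d. ((\<lambda>z. f z - g z) has_derivative d) (at z) \<and> (\<forall>c v. d (c *s v) = c * d v)"
    using f g by (intro exI[of _ "\<lambda>v. f' v - g' v"]) (auto intro: has_derivative_diff simp: algebra_simps)
qed

lemma mholomorphic_on_mult:
  assumes "mholomorphic_on f U" "mholomorphic_on g U"
  shows "mholomorphic_on (\<lambda>z. f z * g z) U"
  unfolding mholomorphic_on_def
proof
  fix z assume "z \<in> U"
  then obtain f' g' where f: "(f has_derivative f') (at z)" "\<forall>c v. f' (c *s v) = c * f' v"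
    and g: "(g has_derivative g') (at z)" "\<forall>c v. g' (c *s v) = c * g' v"
    using assms unfolding mholomorphic_on_def by meson
  show "\<exists>d. ((\<lambda>z. f z * g z) has_derivative d) (at z) \<and> (\<forall>c v. d (c *s v) = c * d v)"
    using f g by (intro exI[of _ "\<lambda>v. f z * g' v + f' v * g z"])
      (auto intro: has_derivative_mult simp: algebra_simps)
qed

lemma mholomorphic_on_compose_entire:
  assumes f: "mholomorphic_on f U" and \<phi>: "\<phi> holomorphic_on UNIV"
  shows "mholomorphic_on (\<lambda>z. \<phi> (f z)) U"
  unfolding mholomorphic_on_def
proof
  fix z assume "z \<in> U"
  then obtain f' where f': "(f has_derivative f') (at z)" "\<forall>c v. f' (c *s v) = c * f' v"
    using f unfolding mholomorphic_on_def by meson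
  have "(\<phi> has_field_derivative deriv \<phi> (f z)) (at (f z))"
    using \<phi> by (intro holomorphic_derivI[of _ UNIV]) auto
  then have "(\<phi> has_derivative (*) (deriv \<phi> (f z))) (at (f z))"
    by (simp add: has_field_derivative_def)
  from has_derivative_compose[OF f'(1) this]
  show "\<exists>d. ((\<lambda>z. \<phi> (f z)) has_derivative d) (at z) \<and> (\<forall>c v. d (c *s v) = c * d v)"
    using f'(2) by (intro exI[of _ "\<lambda>v. deriv \<phi> (f z) * f' v"]) auto
qed

lemma mholomorphic_on_continuous: "mholomorphic_on f U \<Longrightarrow> continuous_on U f"
  unfolding mholomorphic_on_def
  by (meson continuous_at_imp_continuous_on has_derivative_continuous)

lemma open_nonzero_set:
  assumes "mholomorphic_on f U" "open U"
  shows "open {z \<in> U. f z \<noteq> 0}"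
proof -
  have "{z \<in> U. f z \<noteq> 0} = U \<inter> f -` (- {0})" by auto
  then show ?thesis
    using continuous_on_open_vimage[OF assms(2)] mholomorphic_on_continuous[OF assms(1)]
    by (metis Int_commute closed_singleton open_Compl)
qed

lemma linear_vector_smult: "linear (\<lambda>t::complex. t *s (v :: complex^'n))"
  by (rule linearI) (simp_all add: vec_eq_iff algebra_simps)

lemma mholomorphic_on_line:
  assumes "mholomorphic_on f U"
  shows "(\<lambda>t. f (q + t *s v)) holomorphic_on {t. q + t *s v \<in> U}"
  unfolding holomorphic_on_def field_differentiable_def
proof
  fix t assume t: "t \<in> {t. q + t *s v \<in> U}"
  then obtain f' where f': "(f has_derivative f') (at (q + t *s v))" "\<forall>c v. f' (c *s v) = c * f' v"
    using assms unfolding mholomorphic_on_def by (metis mem_Collect_eq)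
  have "((\<lambda>t. q + t *s v) has_derivative (\<lambda>t. 0 + t *s v)) (at t)"
    using linear_vector_smult[of v]
    by (intro has_derivative_add has_derivative_const bounded_linear_imp_has_derivative)
       (simp add: linear_conv_bounded_linear)
  from has_derivative_compose[OF this f'(1)]
  have "((\<lambda>t. f (q + t *s v)) has_field_derivative f' v) (at t)"
    using f'(2) by (simp add: has_field_derivative_def mult.commute[of _ "f' v"])
  then show "\<exists>D. ((\<lambda>t. f (q + t *s v)) has_field_derivative D) (at t within {t. q + t *s v \<in> U})"
    using has_field_derivative_at_within by blast
qed

text \<open>
  The interior of the zero set is open and, in \<open>U\<close>, also closed: in a ball around a limit point,
  every point lies on a complex line through a point of the interior, and along that line the function
  of one variable vanishes near one parameter, hence everywhere.
\<close>

theorem mholomorphic_identity: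
  fixes f :: "complex^'n \<Rightarrow> complex"
  assumes f: "mholomorphic_on f U" and U: "open U" "connected U"
    and V: "open V" "V \<noteq> {}" "V \<subseteq> U" "\<And>z. z \<in> V \<Longrightarrow> f z = 0"
    and z: "z \<in> U"
  shows "f z = 0"
proof -
  define Z where "Z = interior {z \<in> U. f z = 0}"
  have Z: "open Z" "Z \<subseteq> U" "\<And>z. z \<in> Z \<Longrightarrow> f z = 0"
    using interior_subset[of "{z \<in> U. f z = 0}"] by (auto simp: Z_def)
  have VZ: "V \<subseteq> Z"
    using V unfolding Z_def by (intro interior_maximal) auto
  have closed: "p \<in> Z" if p: "p \<in> U" "p \<in> closure Z" for p
  proof -
    obtain r where r: "r > 0" "ball p r \<subseteq> U" using U(1) p(1) open_contains_ball by blast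
    obtain q where q: "q \<in> Z" "q \<in> ball p r"
      using p(2) r(1) unfolding closure_approachable mem_ball by (metis dist_commute)
    have "f w = 0" if w: "w \<in> ball p r" for w
    proof -
      define L where "L t = q + t *s (w - q)" for t
      have contL: "continuous_on UNIV L"
        unfolding L_def using linear_vector_smult[of "w - q"]
        by (intro continuous_on_add continuous_on_const linear_continuous_on) (simp add: linear_conv_bounded_linear)
      let ?S = "L -` ball p r" and ?T = "L -` (Z \<inter> ball p r)"
      have "dist p (L t) = dist (p - q) (t *s (w - q))" for t
        by (simp only: L_def dist_norm diff_diff_eq)
      then have "?S = (\<lambda>t. t *s (w - q)) -` ball (p - q) r"
        by (intro set_eqI) (simp only: vimage_eq mem_ball)
      then have "connected ?S"
        by (simp only: convex_connected convex_linear_vimage linear_vector_smult convex_ball)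
      moreover have "open ?S" "open ?T"
        using contL Z(1) by (auto intro!: open_vimage)
      moreover have "0 \<in> ?T" "1 \<in> ?S" using q w by (auto simp: L_def)
      moreover have "(\<lambda>t. f (L t)) holomorphic_on ?S"
        using mholomorphic_on_line[OF mholomorphic_on_subset[OF f r(2)], of q "w - q"]
        by (simp add: L_def vimage_def)
      ultimately have "f (L 1) = 0"
        using Z(3) by (intro analytic_continuation_open[of ?T ?S "\<lambda>t. f (L t)" "\<lambda>_. 0" 1]) auto
      then show ?thesis by (simp add: L_def)
    qed
    then have "ball p r \<subseteq> Z"
      unfolding Z_def using r by (intro interior_maximal) auto
    then show ?thesis using r(1) by auto
  qed
  have "Z \<inter> U = {} \<or> - closure Z \<inter> U = {}"
    using closed closure_subset[of Z] Z(1) by (intro connectedD[OF U(2)]) auto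
  moreover have "Z \<inter> U \<noteq> {}" using VZ V(2) Z(2) by blast
  ultimately have "z \<in> Z" using z closed by blast
  then show ?thesis by (rule Z(3))
qed

text \<open>
  The points near which the two functions agree generically form an open set; it is closed because
  near a limit point the functions are \<open>g1 / h1\<close> and \<open>g2 / h2\<close>, and the holomorphic function
  \<open>(g1 h2 - g2 h1) h1 h2\<close> vanishes on an open set, hence on a ball.
  The factor \<open>h1 h2\<close> covers the points where the quotients say nothing.
\<close>

theorem mmeromorphic_identity:
  assumes f: "mmeromorphic_on f UNIV" and g: "mmeromorphic_on g UNIV"
    and W: "open W" "W \<noteq> {}" "\<And>z. z \<in> W \<Longrightarrow> f z = g z"
  shows "mmeromorphic_eq_on f g UNIV"
proof -
  define good where "good p U h \<longleftrightarrow> open U \<and> connected U \<and> p \<in> U \<and> mholomorphic_on h U \<and>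
    (\<exists>z\<in>U. h z \<noteq> 0) \<and> (\<forall>z\<in>U. h z \<noteq> 0 \<longrightarrow> f z = g z)" for p U h
  define A where "A = {p. \<exists>U h. good p U h}"
  have "open A"
  proof (rule openI)
    fix p assume "p \<in> A"
    then obtain U h where U: "good p U h" by (auto simp: A_def)
    then have "open U" "p \<in> U" by (auto simp: good_def)
    moreover have "U \<subseteq> A" using U unfolding A_def good_def by blast
    ultimately show "\<exists>e>0. ball p e \<subseteq> A" using open_contains_ball by (metis subset_trans)
  qed
  moreover have "A \<noteq> {}"
  proof -
    obtain p where "p \<in> W" using W(2) by auto
    then obtain r where r: "r > 0" "ball p r \<subseteq> W" using W(1) open_contains_ball by blast
    then have "good p (ball p r) (\<lambda>_. 1)"
      using W(3) by (auto simp: good_def mholomorphic_on_const intro!: exI[of _ p])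
    then show ?thesis by (auto simp: A_def)
  qed
  moreover have "closed A"
  proof -
    have "p \<in> A" if p: "p \<in> closure A" for p
    proof -
      obtain U1 g1 h1 where U1: "open U1" "connected U1" "p \<in> U1" "mholomorphic_on g1 U1" "mholomorphic_on h1 U1"
        "\<exists>z\<in>U1. h1 z \<noteq> 0" "\<forall>z\<in>U1. h1 z \<noteq> 0 \<longrightarrow> f z = g1 z / h1 z"
        using f unfolding mmeromorphic_on_def by (metis UNIV_I)
      obtain U2 g2 h2 where U2: "open U2" "connected U2" "p \<in> U2" "mholomorphic_on g2 U2" "mholomorphic_on h2 U2"
        "\<exists>z\<in>U2. h2 z \<noteq> 0" "\<forall>z\<in>U2. h2 z \<noteq> 0 \<longrightarrow> g z = g2 z / h2 z"
        using g unfolding mmeromorphic_on_def by (metis UNIV_I)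
      obtain r where r: "r > 0" "ball p r \<subseteq> U1 \<inter> U2"
        using U1(1,3) U2(1,3) open_contains_ball[of "U1 \<inter> U2"] by blast
      let ?B = "ball p r"
      have hol: "mholomorphic_on g1 ?B" "mholomorphic_on h1 ?B" "mholomorphic_on g2 ?B" "mholomorphic_on h2 ?B"
        using U1(4,5) U2(4,5) r(2) by (auto intro: mholomorphic_on_subset)
      define k where "k z = h1 z * h2 z" for z
      have k: "mholomorphic_on k ?B" unfolding k_def using hol by (intro mholomorphic_on_mult)
      have nz: "\<exists>z\<in>?B. k z \<noteq> 0"
      proof (rule ccontr)
        assume "\<not> ?thesis"
        then have zero: "h1 z * h2 z = 0" if "z \<in> ?B" for z using that by (auto simp: k_def)
        obtain z where "z \<in> ?B" "h1 z \<noteq> 0"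
          using mholomorphic_identity[OF U1(5,1,2), of ?B] U1(6) r by (metis Int_subset_iff centre_in_ball empty_iff open_ball)
        then have ne: "{z \<in> ?B. h1 z \<noteq> 0} \<noteq> {}" by auto
        have "h2 z = 0" if "z \<in> U2" for z
        proof (rule mholomorphic_identity[OF U2(5,1,2) open_nonzero_set[OF hol(2) open_ball] ne _ _ that])
          show "{z \<in> ?B. h1 z \<noteq> 0} \<subseteq> U2" using r(2) by auto
        qed (use zero in auto)
        then show False using U2(6) by auto
      qed
      obtain q where q: "q \<in> A" "q \<in> ?B"
        using p r(1) unfolding closure_approachable mem_ball by (metis dist_commute)
      then obtain U3 h3 where U3: "good q U3 h3" by (auto simp: A_def)
      then have o3: "open U3" "connected U3" "q \<in> U3" "mholomorphic_on h3 U3" "\<exists>z\<in>U3. h3 z \<noteq> 0"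
        "\<forall>z\<in>U3. h3 z \<noteq> 0 \<longrightarrow> f z = g z" by (auto simp: good_def)
      let ?V = "{z \<in> U3 \<inter> ?B. h3 z \<noteq> 0}"
      have oV: "open ?V"
        by (rule open_nonzero_set) (use o3 in \<open>auto intro: mholomorphic_on_subset\<close>)
      have neV: "?V \<noteq> {}"
      proof
        assume "?V = {}"
        then have "h3 z = 0" if "z \<in> U3" for z
          using mholomorphic_identity[OF o3(4,1,2), of "U3 \<inter> ?B" z] o3(1,3) q(2) that by blast
        then show False using o3(5) by auto
      qed
      have "(g1 z * h2 z - g2 z * h1 z) * k z = 0" if "z \<in> ?B" for z
      proof (rule mholomorphic_identity[of "\<lambda>z. (g1 z * h2 z - g2 z * h1 z) * k z" ?B ?V])
        show "mholomorphic_on (\<lambda>z. (g1 z * h2 z - g2 z * h1 z) * k z) ?B"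
          using hol k by (intro mholomorphic_on_mult mholomorphic_on_diff)
        fix z assume z: "z \<in> ?V"
        show "(g1 z * h2 z - g2 z * h1 z) * k z = 0"
        proof (cases "k z = 0")
          case False
          then have "h1 z \<noteq> 0" "h2 z \<noteq> 0" by (auto simp: k_def)
          moreover have "z \<in> U1" "z \<in> U2" using z r(2) by auto
          ultimately have "g1 z / h1 z = g2 z / h2 z" using z o3(6) U1(7) U2(7) by auto
          with \<open>h1 z \<noteq> 0\<close> \<open>h2 z \<noteq> 0\<close> show ?thesis by (simp add: field_simps)
        qed simp
      qed (use oV neV that in auto)
      then have "f z = g z" if "z \<in> ?B" "k z \<noteq> 0" for z
      proof -
        have h: "h1 z \<noteq> 0" "h2 z \<noteq> 0" using that by (auto simp: k_def)
        moreover have "g1 z * h2 z = g2 z * h1 z"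
          using \<open>\<And>z. z \<in> ?B \<Longrightarrow> (g1 z * h2 z - g2 z * h1 z) * k z = 0\<close>[OF that(1)] that(2) by simp
        moreover have "z \<in> U1" "z \<in> U2" using that r(2) by auto
        ultimately show ?thesis using U1(7) U2(7) by (simp add: frac_eq_eq)
      qed
      then have "good p ?B k" using r(1) k nz by (auto simp: good_def)
      then show ?thesis by (auto simp: A_def)
    qed
    then show ?thesis using closure_subset_eq by blast
  qed
  ultimately have "A = UNIV" using clopen by blast
  then show ?thesis
    unfolding mmeromorphic_eq_on_def A_def good_def by blast
qed

section \<open>The meromorphic continuation\<close>

lemma tau_meromorphic: "mmeromorphic_on tau UNIV"
proof -
  define g where "g \<mu> = of_real ((2 * pi powr (3/2)) ^ 3) * (rGamma ((\<mu>$1 - \<mu>$1 - \<mu>$2 - \<mu>$3) * (1/2)) *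
     rGamma ((\<mu>$2 - \<mu>$1 - \<mu>$2 - \<mu>$3) * (1/2)) * rGamma ((\<mu>$3 - \<mu>$1 - \<mu>$2 - \<mu>$3) * (1/2)))"
    for \<mu> :: "complex^3"
  define h where "h \<mu> = rGamma ((0 - \<mu>$1 - \<mu>$2 - \<mu>$3 - 2) * (1/2)) * (rGamma (- 1/2 - \<mu>$1 * (1/2)) *
     rGamma (- 1/2 - \<mu>$2 * (1/2)) * rGamma (- 1/2 - \<mu>$3 * (1/2)))" for \<mu> :: "complex^3"
  have hol: "mholomorphic_on g UNIV" "mholomorphic_on h UNIV"
    unfolding g_def h_def
    by (intro mholomorphic_on_mult mholomorphic_on_const mholomorphic_on_diff mholomorphic_on_nth
        mholomorphic_on_compose_entire[where \<phi> = rGamma, OF _ holomorphic_rGamma])+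
  have eq: "tau \<mu> = g \<mu> / h \<mu>" for \<mu>
  proof -
    have quot: "c * Gamma a * (Gamma b1 / Gamma c1 * (Gamma b2 / Gamma c2) * (Gamma b3 / Gamma c3)) =
        c * (rGamma c1 * rGamma c2 * rGamma c3) / (rGamma a * (rGamma b1 * rGamma b2 * rGamma b3))"
      for a b1 b2 b3 c1 c2 c3 c :: complex
      by (simp add: Gamma_def divide_inverse mult_ac)
    have arg: "x * (1/2) = x / 2" "0 - x = - x" for x :: complex
      by simp_all
    show ?thesis unfolding tau_def prod_UNIV_3 g_def h_def arg by (rule quot)
  qed
  have "h (\<chi> j. -2) \<noteq> 0"
  proof -
    have "rGamma (2 :: complex) \<noteq> 0" "rGamma (1/2 :: complex) \<noteq> 0"
      by (auto simp: rGamma_eq_zero_iff elim!: nonpos_Ints_cases dest: arg_cong[where f = Re])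
    then show ?thesis by (simp add: h_def)
  qed
  then show ?thesis
    unfolding mmeromorphic_on_def using hol eq
    by (intro ballI exI[of _ UNIV] exI[of _ g] exI[of _ h]) auto
qed

theorem mainTheorem3:
  "(\<exists>\<tau>. meromorphic_extension_of_tau1 \<tau>) \<and>
   (\<forall>\<tau>. meromorphic_extension_of_tau1 \<tau> \<longrightarrow>
      mmeromorphic_eq_on \<tau>
        (\<lambda>\<mu>. of_real ((2 * pi powr (3/2)) ^ 3)
            * Gamma ((- \<mu>$1 - \<mu>$2 - \<mu>$3 - 2) / 2)
            * (\<Prod>j\<in>UNIV. Gamma (- 1/2 - \<mu>$j / 2)
                 / Gamma ((\<mu>$j - \<mu>$1 - \<mu>$2 - \<mu>$3) / 2)))
        UNIV)"
proof -
  have "meromorphic_extension_of_tau1 tau"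
    unfolding meromorphic_extension_of_tau1_def
    by (simp add: tau_meromorphic tau1_integral_eq)
  moreover have "mmeromorphic_eq_on \<tau> tau UNIV" if "meromorphic_extension_of_tau1 \<tau>" for \<tau>
  proof (rule mmeromorphic_identity[OF _ tau_meromorphic])
    show "mmeromorphic_on \<tau> UNIV"
      using that by (simp add: meromorphic_extension_of_tau1_def)
    have "tau1_domain = (\<Inter>j. {\<mu>. Re (\<mu>$j) < -1})"
      by (auto simp: tau1_domain_iff)
    moreover have "open (\<Inter>j. {\<mu> :: complex^3. Re (\<mu>$j) < -1})"
      by (intro open_INT ballI open_Collect_less continuous_intros) auto
    ultimately show "open tau1_domain" by simp
    have "(\<chi> j. -2) \<in> tau1_domain" by (simp add: tau1_domain_iff)
    then show "tau1_domain \<noteq> {}" by blast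
    show "\<tau> \<mu> = tau \<mu>" if "\<mu> \<in> tau1_domain" for \<mu>
      using that \<open>meromorphic_extension_of_tau1 \<tau>\<close>
      by (simp add: meromorphic_extension_of_tau1_def tau1_integral_eq)
  qed
  ultimately show ?thesis
    unfolding tau_def[abs_def] by blast
qed

end
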